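(* Let $G$ be a countable amenable group and let $(X,\mu,G,\varphi)$ be a multiordered dynamical system, i.e. a measure-preserving action $(X,\mu,G)$ on a standard probability space together with a fixed measure-theoretic factor map $\varphi:(X,\mu,G)\to(\tilde{\mathcal O},\nu,G)$ to a multiorder. The Pinsker sigma-algebra $\Pi_G(X|\Sigma_{\tilde{\mathcal O}})$ of the system $(X,\mu,G)$ relative to the multiorder $\tilde{\mathcal O}$ is equal to the Pinsker sigma-algebra $\Pi_S(X|\Sigma_{\tilde{\mathcal O}})$ of the $\mathbb Z$-action $(X,\mu,S)$ relative to the multiorder $\tilde{\mathcal O}$, where $S$ is the successor map on $X$ associated with the multiorder $\tilde{\mathcal O}$, i.e. $S(x)=g(x)$ with $g=1^{\varphi(x)}$.
   Context: A countable amenable group means an infinite countable discrete group $G$ (unit $e$) in which there is a Følner sequence, i.e. a sequence of finite subsets $F_n\subset G$ with $\lim_n |F_n\cap gF_n|/|F_n|=1$ for every $g\in G$. A linear order $\prec$ on $G$ is of type $\mathbb Z$ if every order interval $[a,b]^{\prec}=\{a,b\}\cup\{g\in G: a\prec g\prec b\}$ ($a\prec b$) is finite and $G$ has no minimal or maximal element. The set $\tilde{\mathcal O}$ of all orders of type $\mathbb Z$ on $G$ is a Borel subset of $\{0,1\}^{G\times G}$ (relations identified with their indicator functions, product topology), with the inherited Borel sigma-algebra. $G$ acts on $\tilde{\mathcal O}$ by: $\prec'=g(\prec)$ where $a\prec' b\iff ag\prec bg$. A multiorder on $G$ is the measure-preserving action $(\tilde{\mathcal O},\nu,G)$, where $\nu$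 is a $G$-invariant Borel probability measure on $\tilde{\mathcal O}$. For $\prec\,\in\tilde{\mathcal O}$, $1^{\prec}\in G$ denotes the successor of $e$ in $\prec$. $\Sigma_{\tilde{\mathcal O}}$ is the sub-sigma-algebra on $X$ consisting of the $\varphi$-preimages of Borel subsets of $\tilde{\mathcal O}$. It is a preliminary fact that $S$ is an invertible $\mu$-preserving map with the same orbits as $G$ (a.e.) and that $\Sigma_{\tilde{\mathcal O}}$ is invariant under both $G$ and $S$. Entropy: $H(\mu,\mathcal P)=-\sum_{P\in\mathcal P}\mu(P)\log\mu(P)$ for a finite measurable partition $\mathcal P$; $H(\mu,\mathcal P|\Theta)=\inf_{\mathcal Q}\bigl(H(\mu,\mathcal P\vee\mathcal Q)-H(\mu,\mathcal Q)\bigr)$ over finite $\Theta$-measurable partitions $\mathcal Q$; for $G$-invariant $\Theta$, $h(\mu,G,\mathcal P|\Theta)=\lim_n\frac1{|F_n|}H\bigl(\mu,\bigvee_{g\in F_n}g^{-1}(\mathcal P)\,\big|\,\Theta\bigr)$ for any Følner sequence $(F_n)$. The Pinsker sigma-algebra $\Pi_G(X|\Theta)$ consists of all measurable sets $A\subset X$ with $h(\mu,G,\{A,A^c\}|\Theta)=0$; $\Pi_S(X|\Theta)$ is the same notion for the $\mathbb Z$-action generated by $S$. *)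

theory Defs
  imports "HOL-Probability.Probability"
begin

text \<open>
  Groups are types of the class \<open>group_add\<close>, which is not assumed commutative: the product \<open>gh\<close> is
  written \<open>g + h\<close> and the unit \<open>e\<close> is \<open>0\<close>.
\<close>

definition folner :: "(nat \<Rightarrow> 'g::group_add set) \<Rightarrow> bool" where
  "folner F \<longleftrightarrow> (\<forall>n. finite (F n)) \<and>
     (\<forall>g. (\<lambda>n. real (card (F n \<inter> (\<lambda>h. g + h) ` F n)) / real (card (F n))) \<longlonglongrightarrow> 1)"

definition countable_amenable_group :: "'g::group_add itself \<Rightarrow> bool" where
  "countable_amenable_group _ \<longleftrightarrow>
     infinite (UNIV :: 'g set) \<and> countable (UNIV :: 'g set) \<and> (\<exists>F :: nat \<Rightarrow> 'g set. folner F)"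


section \<open>Probability-measure-preserving actions\<close>

definition standard_borel :: "'x measure \<Rightarrow> bool" where
  "standard_borel M \<longleftrightarrow> (\<exists>T. topspace T = space M \<and> completely_metrizable_space T \<and>
     second_countable T \<and> sets M = sigma_sets (space M) {U. openin T U})"

text \<open>Both usual conventions are admitted: a Borel probability on a standard Borel space, and the
  completion of such a measure.\<close>

definition standard_prob_space :: "'x measure \<Rightarrow> bool" where
  "standard_prob_space M \<longleftrightarrow>
     prob_space M \<and> (standard_borel M \<or> (\<exists>N. standard_borel N \<and> M = completion N))"

definition pmp_action :: "'x measure \<Rightarrow> ('g::group_add \<Rightarrow> 'x \<Rightarrow> 'x) \<Rightarrow> bool" where
  "pmp_action M act \<longleftrightarrow> prob_space M \<and>
     (\<forall>x\<in>space M. act 0 x = x) \<and>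
     (\<forall>g h. \<forall>x\<in>space M. act (g + h) x = act g (act h x)) \<and>
     (\<forall>g. act g \<in> measurable M M \<and> distr M M (act g) = M)"

definition factor_map ::
  "'x measure \<Rightarrow> ('g \<Rightarrow> 'x \<Rightarrow> 'x) \<Rightarrow> 'y measure \<Rightarrow> ('g \<Rightarrow> 'y \<Rightarrow> 'y) \<Rightarrow> ('x \<Rightarrow> 'y) \<Rightarrow> bool" where
  "factor_map M act N act' \<phi> \<longleftrightarrow> \<phi> \<in> measurable M N \<and> distr M N \<phi> = N \<and>
     (\<forall>g. AE x in M. \<phi> (act g x) = act' g (\<phi> x))"


section \<open>Multiorders\<close>

text \<open>A strict relation on the group is its indicator function \<open>r :: 'g \<times> 'g \<Rightarrow> bool\<close>, so the
  library topology on this function type is the product topology on \<open>{0,1}\<close> to the power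
  \<open>G \<times> G\<close>.\<close>

definition order_interval :: "('g \<times> 'g \<Rightarrow> bool) \<Rightarrow> 'g \<Rightarrow> 'g \<Rightarrow> 'g set" where
  "order_interval r a b = {a, b} \<union> {g. r (a, g) \<and> r (g, b)}"

definition Z_orders :: "('g \<times> 'g \<Rightarrow> bool) set" where
  "Z_orders = {r. strict_linear_order_on UNIV {p. r p} \<and>
     (\<forall>a b. r (a, b) \<longrightarrow> finite (order_interval r a b)) \<and>
     (\<forall>a. \<exists>b. r (b, a)) \<and> (\<forall>a. \<exists>b. r (a, b))}"

definition order_act :: "'g::group_add \<Rightarrow> ('g \<times> 'g \<Rightarrow> bool) \<Rightarrow> ('g \<times> 'g \<Rightarrow> bool)" where
  "order_act g r = (\<lambda>(a, b). r (a + g, b + g))"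

definition multiorder :: "('g::group_add \<times> 'g \<Rightarrow> bool) measure \<Rightarrow> bool" where
  "multiorder \<nu> \<longleftrightarrow> space \<nu> = Z_orders \<and> sets \<nu> = sets (restrict_space borel Z_orders) \<and>
     pmp_action \<nu> order_act"

definition succ_unit :: "('g::group_add \<times> 'g \<Rightarrow> bool) \<Rightarrow> 'g" where
  "succ_unit r = (THE s. r (0, s) \<and> \<not> (\<exists>c. r (0, c) \<and> r (c, s)))"

definition successor_map ::
  "('g::group_add \<Rightarrow> 'x \<Rightarrow> 'x) \<Rightarrow> ('x \<Rightarrow> 'g \<times> 'g \<Rightarrow> bool) \<Rightarrow> 'x \<Rightarrow> 'x" where
  "successor_map act \<phi> x = act (succ_unit (\<phi> x)) x"

definition multiorder_algebra :: "'x measure \<Rightarrow> ('x \<Rightarrow> 'g \<times> 'g \<Rightarrow> bool) \<Rightarrow> 'x set set" where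
  "multiorder_algebra M \<phi> = {\<phi> -` B \<inter> space M | B. B \<in> sets (restrict_space borel Z_orders)}"

text \<open>The factor map is equivariant only almost everywhere, so the successor map \<open>S\<close> is invertible
  only almost everywhere.  Its inverse is any measurable map that is inverse to \<open>S\<close> almost
  everywhere; it is determined up to a null set, which does not affect entropies.\<close>

definition ae_inverse :: "'x measure \<Rightarrow> ('x \<Rightarrow> 'x) \<Rightarrow> 'x \<Rightarrow> 'x" where
  "ae_inverse M S = (SOME R. R \<in> measurable M M \<and>
     (AE x in M. R (S x) = x) \<and> (AE x in M. S (R x) = x))"

definition Z_action :: "'x measure \<Rightarrow> ('x \<Rightarrow> 'x) \<Rightarrow> int \<Rightarrow> 'x \<Rightarrow> 'x" where
  "Z_action M S i = (if 0 \<le> i then S ^^ nat i else ae_inverse M S ^^ nat (- i))"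


section \<open>Entropy\<close>

text \<open>Cells may be empty, so that \<open>{A, A\<^sup>c}\<close> is always a partition; since \<open>ln 0 = 0\<close>, an empty cell
  contributes nothing to the entropy.\<close>

definition fin_partition :: "'x measure \<Rightarrow> 'x set set \<Rightarrow> bool" where
  "fin_partition M P \<longleftrightarrow> finite P \<and> P \<subseteq> sets M \<and> disjoint P \<and> \<Union>P = space M"

definition join :: "'x set set \<Rightarrow> 'x set set \<Rightarrow> 'x set set" where
  "join P Q = {A \<inter> B | A B. A \<in> P \<and> B \<in> Q}"

text \<open>The join of the preimages of \<open>P\<close> under \<open>T g\<close>, \<open>g \<in> F\<close>.\<close>

definition orbit_join ::
  "'x measure \<Rightarrow> ('g \<Rightarrow> 'x \<Rightarrow> 'x) \<Rightarrow> 'x set set \<Rightarrow> 'g set \<Rightarrow> 'x set set" where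
  "orbit_join M T P F = {{x \<in> space M. \<forall>g\<in>F. T g x \<in> p g} | p. p \<in> F \<rightarrow>\<^sub>E P}"

definition part_entropy :: "'x measure \<Rightarrow> 'x set set \<Rightarrow> real" where
  "part_entropy M P = - (\<Sum>A\<in>P. measure M A * ln (measure M A))"

definition rel_part_entropy :: "'x measure \<Rightarrow> 'x set set \<Rightarrow> 'x set set \<Rightarrow> real" where
  "rel_part_entropy M P \<Theta> =
     (INF Q \<in> {Q. fin_partition M Q \<and> Q \<subseteq> \<Theta>}. part_entropy M (join P Q) - part_entropy M Q)"

text \<open>The common limit along all Folner sequences.\<close>

definition rel_entropy ::
  "'x measure \<Rightarrow> ('g::group_add \<Rightarrow> 'x \<Rightarrow> 'x) \<Rightarrow> 'x set set \<Rightarrow> 'x set set \<Rightarrow> real" where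
  "rel_entropy M T P \<Theta> = (THE h. \<forall>F. folner F \<longrightarrow>
     (\<lambda>n. rel_part_entropy M (orbit_join M T P (F n)) \<Theta> / real (card (F n))) \<longlonglongrightarrow> h)"

definition pinsker ::
  "'x measure \<Rightarrow> ('g::group_add \<Rightarrow> 'x \<Rightarrow> 'x) \<Rightarrow> 'x set set \<Rightarrow> 'x set set" where
  "pinsker M T \<Theta> = {A \<in> sets M. rel_entropy M T {A, space M - A} \<Theta> = 0}"

end

theory Submission
  imports Defs
begin

text \<open>
  For a countable-valued code \<open>Z\<close> let \<open>info Z x\<close> be minus the logarithm of the measure of the fibre of
  \<open>Z\<close> through \<open>x\<close>; conditional entropies are integrals of differences of such functions, so that the
  chain rule and the localisation to sets seen by the conditioning code hold pointwise.

  Fix a set \<open>A\<close>. Given the multiorder, the partition generated by \<open>A\<close> along a finite \<open>F \<subseteq> G\<close> is exposed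
  one element of \<open>F\<close> at a time, in the order \<open>\<phi> x\<close>. By invariance the contribution of \<open>g\<close> is the entropy
  of the event \<open>x \<in> A\<close> given its history along a finite part of the past of the unit in the order. This
  is at least the infimum \<open>h\<close> over all finite pasts that may depend on the order, and for a Folner set
  it is nearly \<open>h\<close> for most \<open>g\<close>; hence \<open>h\<close> is the relative entropy. The argument applies to any group
  with an equivariant order, in particular to the action of the integers by \<open>S\<close> with the usual order
  on the integers. The infimum \<open>h\<close> is the same for both, because conditionally on the multiorder the
  past \<open>{S\<^sup>k x | k < 0}\<close> is the past of \<open>x\<close> along the group elements that precede the unit.
\<close>

section \<open>Information functions\<close>

text \<open>A countable-valued code of any type: measurability is asked of its fibres only, so the
  target carries no sigma-algebra and codes may be sets, pairs or orders on a finite set.\<close>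

definition discrete_rv :: "'x measure \<Rightarrow> ('x \<Rightarrow> 'z) \<Rightarrow> bool" where
  "discrete_rv M Z \<longleftrightarrow> countable (Z ` space M) \<and> (\<forall>x\<in>space M. {y \<in> space M. Z y = Z x} \<in> sets M)"

definition cell :: "'x measure \<Rightarrow> ('x \<Rightarrow> 'z) \<Rightarrow> 'x \<Rightarrow> 'x set" where
  "cell M Z x = {y \<in> space M. Z y = Z x}"

text \<open>Points in null fibres get the value 0 by \<open>ln 0 = 0\<close>; they form a null set
  by \<open>AE_cell_pos\<close>.\<close>

definition info :: "'x measure \<Rightarrow> ('x \<Rightarrow> 'z) \<Rightarrow> 'x \<Rightarrow> real" where
  "info M Z x = - ln (measure M (cell M Z x))"

text \<open>Almost everywhere this is minus the logarithm of the conditional probability of the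
  \<open>L\<close>-fibre inside the \<open>Z\<close>-fibre, with the conditional entropy of
  \<open>L\<close> given \<open>Z\<close> as its integral. It can be integrable although
  \<open>info M Z\<close> is not, so \<open>Z\<close> may have infinite entropy.\<close>

definition cond_info :: "'x measure \<Rightarrow> ('x \<Rightarrow> 'l) \<Rightarrow> ('x \<Rightarrow> 'z) \<Rightarrow> 'x \<Rightarrow> real" where
  "cond_info M L Z x = info M (\<lambda>y. (L y, Z y)) x - info M Z x"

section \<open>Closure properties of countable-valued codes\<close>

lemma discrete_rv_fibre:
  assumes "discrete_rv M Z"
  shows "{y \<in> space M. Z y = z} \<in> sets M"
proof (cases "z \<in> Z ` space M")
  case True
  then show ?thesis using assms unfolding discrete_rv_def by auto
next
  case False
  then have "{y \<in> space M. Z y = z} = {}" by auto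
  then show ?thesis by (metis sets.empty_sets)
qed

text \<open>Every preimage under \<open>f\<close> is a countable union of fibres of
  \<open>Z\<close>.\<close>

lemma discrete_rv_measurable:
  assumes Z: "discrete_rv M Z"
    and f: "\<And>x y. x \<in> space M \<Longrightarrow> y \<in> space M \<Longrightarrow> Z x = Z y \<Longrightarrow> f x = f y"
    and sp: "\<And>x. x \<in> space M \<Longrightarrow> f x \<in> space N"
  shows "f \<in> measurable M N"
proof (rule measurableI)
  fix S assume "S \<in> sets N"
  let ?C = "Z ` {x \<in> space M. f x \<in> S}"
  have "f -` S \<inter> space M = (\<Union>z\<in>?C. {y \<in> space M. Z y = z})"
  proof (intro set_eqI iffI)
    fix y assume "y \<in> (\<Union>z\<in>?C. {y \<in> space M. Z y = z})"
    then obtain x where "x \<in> space M" "f x \<in> S" "y \<in> space M" "Z y = Z x" by auto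
    then show "y \<in> f -` S \<inter> space M" using f[of x y] by simp
  qed auto
  moreover have "countable ?C"
    using Z unfolding discrete_rv_def by (rule_tac countable_subset[of _ "Z ` space M"]) auto
  ultimately show "f -` S \<inter> space M \<in> sets M"
    using discrete_rv_fibre[OF Z] by (metis (no_types, lifting) sets.countable_UN'')
qed (use sp in auto)

lemma discrete_rv_pred:
  assumes Z: "discrete_rv M Z"
  shows "{x \<in> space M. b (Z x)} \<in> sets M"
proof -
  have "(\<lambda>x. b (Z x)) \<in> measurable M (count_space UNIV)"
    by (rule discrete_rv_measurable[OF Z]) auto
  then show ?thesis by simp
qed

lemma discrete_rv_coarser:
  assumes Z: "discrete_rv M Z"
    and f: "\<And>x y. x \<in> space M \<Longrightarrow> y \<in> space M \<Longrightarrow> Z x = Z y \<Longrightarrow> f x = f y"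
  shows "discrete_rv M f"
proof -
  \<comment> \<open>\<open>s\<close> selects a point from each fibre, so \<open>f\<close> factors
    through the countably many values of \<open>Z\<close>.\<close>
  obtain s where s: "\<And>x. x \<in> space M \<Longrightarrow> s (Z x) \<in> space M \<and> Z (s (Z x)) = Z x"
    using that[of "\<lambda>z. SOME x. x \<in> space M \<and> Z x = z"]
    by (metis (mono_tags, lifting) someI_ex)
  have "f x = f (s (Z x))" if "x \<in> space M" for x
    using s[OF that] f[OF that, of "s (Z x)"] by simp
  then have "f ` space M \<subseteq> (\<lambda>z. f (s z)) ` (Z ` space M)" by auto
  then have "countable (f ` space M)"
    using Z unfolding discrete_rv_def by (meson countable_image countable_subset)
  moreover have "f \<in> measurable M (count_space UNIV)"
    by (rule discrete_rv_measurable[OF Z f]) auto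
  then have "\<And>z. {y \<in> space M. f y = z} \<in> sets M" by simp
  ultimately show ?thesis unfolding discrete_rv_def by auto
qed

lemma discrete_rv_Pair:
  assumes "discrete_rv M Z" "discrete_rv M W"
  shows "discrete_rv M (\<lambda>x. (Z x, W x))"
  unfolding discrete_rv_def
proof (intro conjI ballI)
  have "(\<lambda>x. (Z x, W x)) ` space M \<subseteq> Z ` space M \<times> W ` space M" by auto
  then show "countable ((\<lambda>x. (Z x, W x)) ` space M)"
    using assms unfolding discrete_rv_def by (meson countable_SIGMA countable_subset)
  fix x
  have "{y \<in> space M. (Z y, W y) = (Z x, W x)} =
        {y \<in> space M. Z y = Z x} \<inter> {y \<in> space M. W y = W x}" by auto
  then show "{y \<in> space M. (Z y, W y) = (Z x, W x)} \<in> sets M"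
    using discrete_rv_fibre[OF assms(1)] discrete_rv_fibre[OF assms(2)] by auto
qed

lemma discrete_rv_comp:
  assumes "discrete_rv N Z" "T \<in> measurable M N"
  shows "discrete_rv M (\<lambda>x. Z (T x))"
  unfolding discrete_rv_def
proof (intro conjI ballI)
  have "(\<lambda>x. Z (T x)) ` space M \<subseteq> Z ` space N"
    using measurable_space[OF assms(2)] by auto
  then show "countable ((\<lambda>x. Z (T x)) ` space M)"
    using assms unfolding discrete_rv_def by (meson countable_subset)
  fix x
  have "{y \<in> space M. Z (T y) = Z (T x)} = T -` {y \<in> space N. Z y = Z (T x)} \<inter> space M"
    using measurable_space[OF assms(2)] by auto
  then show "{y \<in> space M. Z (T y) = Z (T x)} \<in> sets M"
    using discrete_rv_fibre[OF assms(1)] measurable_sets[OF assms(2)] by metis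
qed

lemma discrete_rv_mem:
  assumes "A \<in> sets M"
  shows "discrete_rv M (\<lambda>x. x \<in> A)"
proof -
  have "{y \<in> space M. (y \<in> A) = (x \<in> A)} \<in> sets M" for x
    using assms sets.sets_into_space[OF assms]
    by (cases "x \<in> A") (auto simp: Int_absorb1 Collect_conj_eq intro: sets.sets_Collect_neg)
  then show ?thesis unfolding discrete_rv_def by simp
qed

text \<open>A countable set has only countably many finite subsets, and each fibre of
  \<open>D\<close> is cut out by countably many membership conditions. This makes random finite sets
  usable as codes.\<close>

lemma discrete_rv_finite_set:
  fixes D :: "'x \<Rightarrow> 'g set"
  assumes c: "countable U" and fin: "\<And>x. x \<in> space M \<Longrightarrow> finite (D x) \<and> D x \<subseteq> U"
    and meas: "\<And>g. g \<in> U \<Longrightarrow> {x \<in> space M. g \<in> D x} \<in> sets M"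
  shows "discrete_rv M D"
  unfolding discrete_rv_def
proof (intro conjI ballI)
  have "D ` space M \<subseteq> {A. finite A \<and> A \<subseteq> U}" using fin by auto
  then show "countable (D ` space M)"
    using countable_Collect_finite_subset[OF c] by (meson countable_subset)
  fix x assume x: "x \<in> space M"
  have "{y \<in> space M. D y = D x} = {y \<in> space M. \<forall>g\<in>U. g \<in> D y \<longleftrightarrow> g \<in> D x}"
    using fin x by blast
  also have "\<dots> \<in> sets M"
  proof -
    have "{y \<in> space M. (g \<in> D y) = (g \<in> D x)} \<in> sets M" if "g \<in> U" for g
      using meas[OF that] by (cases "g \<in> D x") (auto intro: sets.sets_Collect_neg)
    then show ?thesis by (rule sets.sets_Collect_countable_All'[OF _ c])
  qed
  finally show "{y \<in> space M. D y = D x} \<in> sets M" .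
qed

section \<open>Measurability and invariance of information functions\<close>

lemma info_cong:
  assumes "\<And>y. y \<in> space M \<Longrightarrow> Z y = Z x \<longleftrightarrow> Z' y = Z' x"
  shows "info M Z x = info M Z' x"
  using assms unfolding info_def cell_def by (metis (mono_tags, lifting) Collect_cong)

lemma info_measurable:
  assumes "discrete_rv M Z"
  shows "info M Z \<in> borel_measurable M"
  by (rule discrete_rv_measurable[OF assms]) (auto simp: info_def cell_def)

lemma cond_info_measurable:
  assumes "discrete_rv M L" "discrete_rv M Z"
  shows "cond_info M L Z \<in> borel_measurable M"
  unfolding cond_info_def[abs_def]
  using info_measurable[OF assms(2)] info_measurable[OF discrete_rv_Pair[OF assms]] by measurable

text \<open>The fibre of the composed code through \<open>x\<close> is the preimage under
  \<open>T\<close> of the fibre of \<open>Z\<close> through \<open>T x\<close>, and \<open>T\<close>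
  preserves the measure.\<close>

lemma info_comp:
  assumes T: "T \<in> measurable M M" "distr M M T = M" and Z: "discrete_rv M Z" and x: "x \<in> space M"
  shows "info M (\<lambda>y. Z (T y)) x = info M Z (T x)"
proof -
  have "cell M (\<lambda>y. Z (T y)) x = T -` {y \<in> space M. Z y = Z (T x)} \<inter> space M"
    using measurable_space[OF T(1)] unfolding cell_def by auto
  then show ?thesis
    using measure_distr[OF T(1) discrete_rv_fibre[OF Z, of "Z (T x)"]] T(2)
    unfolding info_def cell_def by metis
qed

lemma integral_cond_info_comp:
  assumes T: "T \<in> measurable M M" "distr M M T = M" and L: "discrete_rv M L" and Z: "discrete_rv M Z"
  shows "(\<integral>x. cond_info M (\<lambda>y. L (T y)) (\<lambda>y. Z (T y)) x \<partial>M) = (\<integral>x. cond_info M L Z x \<partial>M)"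
proof -
  have "(\<integral>x. cond_info M (\<lambda>y. L (T y)) (\<lambda>y. Z (T y)) x \<partial>M) = (\<integral>x. cond_info M L Z (T x) \<partial>M)"
    unfolding cond_info_def
    using info_comp[OF T Z] info_comp[OF T discrete_rv_Pair[OF L Z]]
    by (intro Bochner_Integration.integral_cong) auto
  also have "\<dots> = (\<integral>x. cond_info M L Z x \<partial>distr M M T)"
    using T(1) cond_info_measurable[OF L Z] by (subst integral_distr) auto
  finally show ?thesis using T(2) by simp
qed

section \<open>Gibbs' inequality and the basic estimates for conditional entropy\<close>

context prob_space
begin

text \<open>The null fibres are countably many, so their union is null.\<close>

lemma AE_cell_pos:
  assumes Z: "discrete_rv M Z"
  shows "AE x in M. 0 < measure M (cell M Z x)"
proof -
  let ?B = "{x \<in> space M. measure M (cell M Z x) = 0}"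
  have "?B = (\<Union>z\<in>Z ` ?B. {y \<in> space M. Z y = z})"
    by (auto simp: cell_def)
  moreover have "countable (Z ` ?B)"
    using Z unfolding discrete_rv_def by (rule_tac countable_subset[of _ "Z ` space M"]) auto
  moreover have "\<And>z. z \<in> Z ` ?B \<Longrightarrow> {y \<in> space M. Z y = z} \<in> null_sets M"
    using discrete_rv_fibre[OF Z] by (auto simp: null_sets_def emeasure_eq_measure cell_def)
  ultimately have "?B \<in> null_sets M" by (metis (no_types, lifting) null_sets_UN')
  then have "AE x in M. x \<notin> ?B" by (rule AE_not_in)
  then show ?thesis by (rule AE_mp) (auto intro!: AE_I2 simp: zero_less_measure_iff less_le)
qed

text \<open>Countable additivity of the measure with density \<open>f\<close>, applied to the fibres
  of \<open>Z\<close>.\<close>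

lemma nn_integral_fibres:
  assumes Z: "discrete_rv M Z" and f[measurable]: "f \<in> borel_measurable M"
  shows "(\<integral>\<^sup>+x. f x \<partial>M) =
    (\<integral>\<^sup>+z. (\<integral>\<^sup>+x. f x * indicator {y \<in> space M. Z y = z} x \<partial>M) \<partial>count_space (Z ` space M))"
proof -
  have "(\<integral>\<^sup>+x. f x \<partial>M) = emeasure (density M f) (space M)"
    by (subst emeasure_density) (auto intro!: nn_integral_cong)
  also have "space M = (\<Union>z\<in>Z ` space M. {y \<in> space M. Z y = z})" by auto
  also have "emeasure (density M f) \<dots> =
      (\<integral>\<^sup>+z. emeasure (density M f) {y \<in> space M. Z y = z} \<partial>count_space (Z ` space M))"
    using Z discrete_rv_fibre[OF Z]
    by (intro emeasure_UN_countable) (auto simp: discrete_rv_def disjoint_family_on_def)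
  also have "\<dots> = (\<integral>\<^sup>+z. (\<integral>\<^sup>+x. f x * indicator {y \<in> space M. Z y = z} x \<partial>M) \<partial>count_space (Z ` space M))"
    using discrete_rv_fibre[OF Z] by (intro nn_integral_cong emeasure_density) auto
  finally show ?thesis .
qed

text \<open>The joint fibre lies in the fibre of \<open>Z\<close>. This gives the bound almost
  everywhere only: on a null joint fibre \<open>ln 0 = 0\<close> makes the joint information vanish
  while that of \<open>Z\<close> may be positive.\<close>

lemma cond_info_nonneg:
  assumes "discrete_rv M L" "discrete_rv M Z"
  shows "AE x in M. 0 \<le> cond_info M L Z x"
  using AE_cell_pos[OF discrete_rv_Pair[OF assms]]
proof (rule AE_mp, intro AE_I2 impI)
  fix x assume "0 < measure M (cell M (\<lambda>x. (L x, Z x)) x)"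
  moreover have "measure M (cell M (\<lambda>x. (L x, Z x)) x) \<le> measure M (cell M Z x)"
    using discrete_rv_fibre[OF assms(2)] by (auto simp: cell_def intro!: finite_measure_mono)
  ultimately show "0 \<le> cond_info M L Z x"
    unfolding cond_info_def info_def by simp
qed

text \<open>Gibbs' inequality for an arbitrary subprobability kernel \<open>q\<close>, localised to
  an event \<open>b\<close> that is seen by \<open>Z\<close>. It follows from
  \<open>ln t \<le> t - 1\<close> at the ratio of \<open>q\<close> to the true conditional
  probability, whose integral over a fibre of \<open>Z\<close> is at most the measure of that fibre.
  Integrability of the conditional information comes out of the same bound.\<close>

lemma Gibbs:
  assumes L: "discrete_rv M L" and fin: "finite (L ` space M)" and Z: "discrete_rv M Z"
    and q0: "\<And>l z. 0 \<le> q l z"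
    and q1: "\<And>z. z \<in> Z ` space M \<Longrightarrow> (\<Sum>l\<in>L ` space M. q l z) \<le> 1"
    and pos: "AE x in M. 0 < q (L x) (Z x)"
    and int: "integrable M (\<lambda>x. of_bool (b (Z x)) * - ln (q (L x) (Z x)))"
  shows "integrable M (\<lambda>x. of_bool (b (Z x)) * cond_info M L Z x)" (is ?I)
    and "(\<integral>x. of_bool (b (Z x)) * cond_info M L Z x \<partial>M)
       \<le> (\<integral>x. of_bool (b (Z x)) * - ln (q (L x) (Z x)) \<partial>M)" (is ?J)
proof -
  let ?LZ = "\<lambda>x. (L x, Z x)"
  let ?b = "\<lambda>x. of_bool (b (Z x)) :: real"
  note LZ = discrete_rv_Pair[OF L Z]
  \<comment> \<open>The ratio of \<open>q\<close> to the conditional probability of the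
    \<open>L\<close>-fibre given the \<open>Z\<close>-fibre.\<close>
  define w where "w x = q (L x) (Z x) * measure M (cell M Z x) / measure M (cell M ?LZ x)" for x
  have w0: "0 \<le> w x" for x using q0 by (simp add: w_def)
  have [measurable]: "?b \<in> borel_measurable M"
    by (rule discrete_rv_measurable[OF Z]) auto
  have [measurable]: "w \<in> borel_measurable M"
    by (rule discrete_rv_measurable[OF LZ]) (auto simp: w_def cell_def)
  have [measurable]: "(\<lambda>x. q (L x) (Z x)) \<in> borel_measurable M"
    by (rule discrete_rv_measurable[OF LZ]) auto
  note [measurable] = cond_info_measurable[OF L Z]
  have fibre: "(\<integral>\<^sup>+x. ennreal (?b x * w x) * indicator {y \<in> space M. Z y = z} x \<partial>M)
     \<le> (\<integral>\<^sup>+x. ennreal (?b x) * indicator {y \<in> space M. Z y = z} x \<partial>M)" if z: "z \<in> Z ` space M" for z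
  proof -
    let ?Fz = "{y \<in> space M. Z y = z}"
    let ?Fl = "\<lambda>l. {y \<in> space M. L y = l \<and> Z y = z}"
    have Fz: "?Fz \<in> sets M" using discrete_rv_fibre[OF Z] .
    have Fl: "?Fl l \<in> sets M" for l using discrete_rv_fibre[OF LZ, of "(l, z)"] by simp
    \<comment> \<open>The constant value of \<open>w\<close> on the joint fibre of \<open>l\<close>
      and \<open>z\<close>.\<close>
    define a where "a l = q l z * measure M ?Fz / measure M (?Fl l)" for l
    have a0: "0 \<le> a l" for l using q0 by (simp add: a_def)
    have "(\<integral>\<^sup>+x. ennreal (?b x * w x) * indicator ?Fz x \<partial>M)
       \<le> (\<integral>\<^sup>+x. (\<Sum>l\<in>L ` space M. ennreal (of_bool (b z) * a l) * indicator (?Fl l) x) \<partial>M)"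
    proof (rule nn_integral_mono)
      fix x assume x: "x \<in> space M"
      show "ennreal (?b x * w x) * indicator ?Fz x
         \<le> (\<Sum>l\<in>L ` space M. ennreal (of_bool (b z) * a l) * indicator (?Fl l) x)"
      proof (cases "Z x = z")
        case True
        have "ennreal (?b x * w x) * indicator ?Fz x = ennreal (of_bool (b z) * a (L x)) * indicator (?Fl (L x)) x"
          using x True by (auto simp: w_def a_def cell_def)
        also have "\<dots> \<le> (\<Sum>l\<in>L ` space M. ennreal (of_bool (b z) * a l) * indicator (?Fl l) x)"
          using x fin by (intro member_le_sum) auto
        finally show ?thesis .
      qed (auto simp: indicator_def)
    qed
    also have "\<dots> = (\<Sum>l\<in>L ` space M. ennreal (of_bool (b z) * a l) * emeasure M (?Fl l))"
      using Fl by (subst nn_integral_sum) (auto simp: nn_integral_cmult_indicator)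
    \<comment> \<open>In general only an inequality: on a null joint fibre the product with the
      measure is 0, whereas the right-hand term may be positive.\<close>
    also have "\<dots> \<le> (\<Sum>l\<in>L ` space M. ennreal (of_bool (b z) * (q l z * measure M ?Fz)))"
      using q0 by (intro sum_mono) (auto simp: a_def emeasure_eq_measure ennreal_mult[symmetric] intro!: ennreal_leI)
    also have "\<dots> = ennreal (\<Sum>l\<in>L ` space M. of_bool (b z) * (q l z * measure M ?Fz))"
      using q0 by (intro sum_ennreal) auto
    also have "(\<Sum>l\<in>L ` space M. of_bool (b z) * (q l z * measure M ?Fz)) =
        of_bool (b z) * measure M ?Fz * (\<Sum>l\<in>L ` space M. q l z)"
      by (subst sum_distrib_left) (intro sum.cong refl, simp only: mult_ac)
    also have "\<dots> \<le> of_bool (b z) * measure M ?Fz * 1"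
      using q1[OF z] by (intro mult_left_mono) auto
    also have "ennreal (of_bool (b z) * measure M ?Fz * 1) =
        (\<integral>\<^sup>+x. ennreal (of_bool (b z)) * indicator ?Fz x \<partial>M)"
      using Fz by (subst nn_integral_cmult_indicator) (auto simp: emeasure_eq_measure ennreal_mult)
    also have "\<dots> = (\<integral>\<^sup>+x. ennreal (?b x) * indicator ?Fz x \<partial>M)"
      by (intro nn_integral_cong) (auto simp: indicator_def)
    finally show ?thesis by (meson ennreal_leI order_trans)
  qed
  have nnw: "(\<integral>\<^sup>+x. ennreal (?b x * w x) \<partial>M) \<le> (\<integral>\<^sup>+x. ennreal (?b x) \<partial>M)"
  proof -
    have "(\<integral>\<^sup>+x. ennreal (?b x * w x) \<partial>M) = (\<integral>\<^sup>+z. (\<integral>\<^sup>+x. ennreal (?b x * w x) *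
        indicator {y \<in> space M. Z y = z} x \<partial>M) \<partial>count_space (Z ` space M))"
      by (rule nn_integral_fibres[OF Z]) measurable
    also have "\<dots> \<le> (\<integral>\<^sup>+z. (\<integral>\<^sup>+x. ennreal (?b x) *
        indicator {y \<in> space M. Z y = z} x \<partial>M) \<partial>count_space (Z ` space M))"
      by (rule nn_integral_mono) (use fibre in simp)
    also have "\<dots> = (\<integral>\<^sup>+x. ennreal (?b x) \<partial>M)"
      by (rule nn_integral_fibres[OF Z, symmetric]) measurable
    finally show ?thesis .
  qed
  have bi: "integrable M ?b"
    by (rule integrable_const_bound[of _ 1]) auto
  have "(\<integral>\<^sup>+x. ennreal (?b x) \<partial>M) < \<infinity>"
    using bi by (simp add: nn_integral_eq_integral)
  then have wi: "integrable M (\<lambda>x. ?b x * w x)"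
    using nnw w0 by (intro integrableI_nonneg) (auto simp: top_unique less_top[symmetric])
  have wle: "(\<integral>x. ?b x * w x \<partial>M) \<le> (\<integral>x. ?b x \<partial>M)"
    using nnw wi bi w0 by (simp add: nn_integral_eq_integral)
  have ae: "AE x in M. 0 \<le> ?b x * cond_info M L Z x \<and>
      ?b x * cond_info M L Z x \<le> ?b x * - ln (q (L x) (Z x)) + ?b x * w x - ?b x"
    using AE_cell_pos[OF Z] AE_cell_pos[OF LZ] pos cond_info_nonneg[OF L Z]
  proof eventually_elim
    case (elim x)
    then have wp: "0 < w x" by (simp add: w_def)
    have "cond_info M L Z x = - ln (q (L x) (Z x)) + ln (w x)"
      using elim by (simp add: cond_info_def info_def w_def ln_mult ln_div)
    also have "\<dots> \<le> - ln (q (L x) (Z x)) + w x - 1"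
      using ln_le_minus_one[OF wp] by simp
    finally show ?case using elim(4) by auto
  qed
  let ?u = "\<lambda>x. ?b x * - ln (q (L x) (Z x)) + ?b x * w x - ?b x"
  have u: "integrable M ?u"
    by (rule Bochner_Integration.integrable_diff[OF Bochner_Integration.integrable_add[OF int wi] bi])
  show I: ?I
  proof (rule Bochner_Integration.integrable_bound[OF u])
    show "AE x in M. norm (?b x * cond_info M L Z x) \<le> norm (?u x)"
    proof (rule AE_mp[OF ae], intro AE_I2 impI)
      have abs_mono: "norm a \<le> norm c" if "0 \<le> a \<and> a \<le> c" for a c :: real
        using that by simp
      fix x
      assume "0 \<le> ?b x * cond_info M L Z x \<and> ?b x * cond_info M L Z x \<le> ?u x"
      then show "norm (?b x * cond_info M L Z x) \<le> norm (?u x)" by (rule abs_mono)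
    qed
  qed measurable
  have "(\<integral>x. ?b x * cond_info M L Z x \<partial>M) \<le> (\<integral>x. ?u x \<partial>M)"
    using ae by (intro integral_mono_AE[OF I u]) (rule AE_mp, assumption, rule AE_I2, rule impI, erule conjunct2)
  also have "\<dots> = (\<integral>x. ?b x * - ln (q (L x) (Z x)) \<partial>M) + (\<integral>x. ?b x * w x \<partial>M) - (\<integral>x. ?b x \<partial>M)"
    unfolding Bochner_Integration.integral_diff[OF Bochner_Integration.integrable_add[OF int wi] bi]
      Bochner_Integration.integral_add[OF int wi] ..
  finally show ?J using wle by simp
qed

text \<open>Gibbs' inequality for the uniform kernel on the finite range of \<open>L\<close>. The
  event \<open>b\<close> allows the bound to be used on a small set only.\<close>

lemma cond_info_bound:
  assumes L: "discrete_rv M L" and fin: "finite (L ` space M)" and Z: "discrete_rv M Z"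
  shows "integrable M (cond_info M L Z)"
    and "(\<integral>x. of_bool (b (Z x)) * cond_info M L Z x \<partial>M) \<le>
       measure M {x \<in> space M. b (Z x)} * ln (card (L ` space M))"
proof -
  let ?c = "card (L ` space M)"
  have c: "0 < ?c" using fin not_empty by (simp add: card_gt_0_iff)
  have meas: "{x \<in> space M. b (Z x)} \<in> sets M" for b
    by (rule discrete_rv_pred[OF Z])
  have e: "of_bool (b (Z x)) * - ln (1 / real ?c) = ln ?c * indicator {x \<in> space M. b (Z x)} x"
    if "x \<in> space M" for x b
    using c that by (simp add: ln_div)
  have int: "integrable M (\<lambda>x. of_bool (b (Z x)) * - ln (1 / real ?c))" for b
    by (subst Bochner_Integration.integrable_cong[OF refl e]) (use meas in \<open>auto simp: emeasure_eq_measure\<close>)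
  have G: "integrable M (\<lambda>x. of_bool (b (Z x)) * cond_info M L Z x)"
     "(\<integral>x. of_bool (b (Z x)) * cond_info M L Z x \<partial>M) \<le> (\<integral>x. of_bool (b (Z x)) * - ln (1 / real ?c) \<partial>M)" for b
    using Gibbs[OF L fin Z, of "\<lambda>_ _. 1 / real ?c" b] c int by auto
  from G(1)[of "\<lambda>_. True"] show "integrable M (cond_info M L Z)" by simp
  have "(\<integral>x. of_bool (b (Z x)) * - ln (1 / real ?c) \<partial>M) = (\<integral>x. ln ?c * indicator {x \<in> space M. b (Z x)} x \<partial>M)"
    by (rule Bochner_Integration.integral_cong[OF refl e])
  also have "\<dots> = measure M {x \<in> space M. b (Z x)} * ln ?c"
    using meas by (simp add: Int_absorb2 sets.sets_into_space mult.commute)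
  finally show "(\<integral>x. of_bool (b (Z x)) * cond_info M L Z x \<partial>M) \<le>
       measure M {x \<in> space M. b (Z x)} * ln (card (L ` space M))"
    using G(2)[of b] by simp
qed

lemma integral_cond_info_nonneg:
  assumes "discrete_rv M L" "discrete_rv M Z"
  shows "0 \<le> (\<integral>x. cond_info M L Z x \<partial>M)"
  using cond_info_nonneg[OF assms] by (rule integral_nonneg_AE)

text \<open>Through a point of \<open>E\<close> the fibres of the two codes differ by a null set and
  hence have equal measure.\<close>

lemma AE_info_cong:
  assumes Z: "discrete_rv M Z" and Z': "discrete_rv M Z'" and E: "AE x in M. E x"
    and eq: "\<And>x y. x \<in> space M \<Longrightarrow> y \<in> space M \<Longrightarrow> E x \<Longrightarrow> E y \<Longrightarrow> Z x = Z y \<longleftrightarrow> Z' x = Z' y"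
  shows "AE x in M. info M Z x = info M Z' x"
  using AE_space E
proof eventually_elim
  case (elim x)
  have "AE y in M. y \<in> cell M Z x \<longleftrightarrow> y \<in> cell M Z' x"
    using AE_space E
  proof eventually_elim
    case (elim y)
    then show ?case using eq[of y x] \<open>x \<in> space M\<close> \<open>E x\<close> by (auto simp: cell_def)
  qed
  then have "measure M (cell M Z x) = measure M (cell M Z' x)"
    using discrete_rv_fibre[OF Z] discrete_rv_fibre[OF Z']
    by (intro measure_eq_AE) (auto simp: cell_def)
  then show ?case by (simp add: info_def)
qed

lemma integral_cond_info_cong:
  assumes L: "discrete_rv M L" "discrete_rv M L'" and Z: "discrete_rv M Z"
    and E: "AE x in M. L x = L' x"
  shows "(\<integral>x. cond_info M L Z x \<partial>M) = (\<integral>x. cond_info M L' Z x \<partial>M)"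
proof (rule integral_cong_AE)
  have "AE x in M. info M (\<lambda>y. (L y, Z y)) x = info M (\<lambda>y. (L' y, Z y)) x"
    by (rule AE_info_cong[OF discrete_rv_Pair[OF L(1) Z] discrete_rv_Pair[OF L(2) Z] E]) auto
  then show "AE x in M. cond_info M L Z x = cond_info M L' Z x"
    unfolding cond_info_def by eventually_elim simp
qed (use cond_info_measurable L Z in auto)

text \<open>The conditional distribution of \<open>L\<close> given the coarser \<open>Z\<close> is an admissible kernel in
  Gibbs' inequality for the finer \<open>Z'\<close>.\<close>

lemma integral_cond_info_mono:
  assumes L: "discrete_rv M L" and fin: "finite (L ` space M)"
    and Z: "discrete_rv M Z" and Z': "discrete_rv M Z'" and E: "AE x in M. E x"
    and fine: "\<And>x y. x \<in> space M \<Longrightarrow> y \<in> space M \<Longrightarrow> E x \<Longrightarrow> E y \<Longrightarrow> Z' x = Z' y \<Longrightarrow> Z x = Z y"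
  shows "(\<integral>x. cond_info M L Z' x \<partial>M) \<le> (\<integral>x. cond_info M L Z x \<partial>M)"
proof -
  note LZ = discrete_rv_Pair[OF L Z]
  \<comment> \<open>\<open>f\<close> recovers the value of the coarser code from that of the finer
    one, through a chosen point of \<open>E\<close>; by \<open>fine\<close> the choice does not
    matter.\<close>
  define f where "f z = Z (SOME x. x \<in> space M \<and> E x \<and> Z' x = z)" for z
  have f: "f (Z' x) = Z x" if "x \<in> space M" "E x" for x
  proof -
    have "\<exists>y. y \<in> space M \<and> E y \<and> Z' y = Z' x" using that by auto
    from someI_ex[OF this] show ?thesis unfolding f_def using fine that by blast
  qed
  define q where "q l z = measure M {y \<in> space M. L y = l \<and> Z y = f z} / measure M {y \<in> space M. Z y = f z}" for l z
  have eq: "AE x in M. 0 < q (L x) (Z' x) \<and> - ln (q (L x) (Z' x)) = cond_info M L Z x"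
    using AE_space E AE_cell_pos[OF Z] AE_cell_pos[OF LZ]
  proof eventually_elim
    case (elim x)
    then show ?case by (simp add: q_def f cond_info_def info_def cell_def ln_div)
  qed
  have m: "(\<lambda>x. - ln (q (L x) (Z' x))) \<in> borel_measurable M"
    by (rule discrete_rv_measurable[OF discrete_rv_Pair[OF L Z']]) auto
  have int: "integrable M (\<lambda>x. - ln (q (L x) (Z' x)))"
    using cond_info_bound(1)[OF L fin Z] eq m cond_info_measurable[OF L Z]
    by (subst integrable_cong_AE[where g = "cond_info M L Z"]) (auto elim!: eventually_mono)
  have sum1: "(\<Sum>l\<in>L ` space M. q l z) \<le> 1" for z
  proof -
    have Fl: "{y \<in> space M. L y = l \<and> Z y = f z} \<in> sets M" for l
      using discrete_rv_fibre[OF LZ, of "(l, f z)"] by simp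
    have "(\<Sum>l\<in>L ` space M. measure M {y \<in> space M. L y = l \<and> Z y = f z})
        = measure M (\<Union>l\<in>L ` space M. {y \<in> space M. L y = l \<and> Z y = f z})"
      using fin Fl by (intro finite_measure_finite_Union[symmetric]) (auto simp: disjoint_family_on_def)
    also have "(\<Union>l\<in>L ` space M. {y \<in> space M. L y = l \<and> Z y = f z}) = {y \<in> space M. Z y = f z}" by auto
    finally show ?thesis unfolding q_def sum_divide_distrib[symmetric] by simp
  qed
  have "(\<integral>x. cond_info M L Z' x \<partial>M) \<le> (\<integral>x. - ln (q (L x) (Z' x)) \<partial>M)"
    using Gibbs(2)[OF L fin Z', of q "\<lambda>_. True"] sum1 int eq
    by (auto simp: q_def elim!: eventually_mono)
  also have "\<dots> = (\<integral>x. cond_info M L Z x \<partial>M)"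
    using eq m cond_info_measurable[OF L Z] by (intro integral_cong_AE) (auto elim!: eventually_mono)
  finally show ?thesis .
qed

end

section \<open>Telescoping along a linear order, and partition entropy as an integral\<close>

text \<open>The sum telescopes along the increasing enumeration of \<open>F\<close>. The induction
  removes the largest element, whose initial segment is all the rest. This is the combinatorial core
  of the chain rule along a random order.\<close>

lemma sum_initial_segments:
  fixes j :: "'g set \<Rightarrow> real"
  assumes r: "strict_linear_order_on UNIV {p. r p}" and fin: "finite F"
  shows "(\<Sum>g\<in>F. j (insert g {h \<in> F. r (h, g)}) - j {h \<in> F. r (h, g)}) = j F - j {}"
  using fin
proof (induction "card F" arbitrary: F)
  case 0
  then show ?case by simp
next
  case (Suc n)
  have irr: "\<not> r (a, a)" for a using r unfolding strict_linear_order_on_def irrefl_def by auto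
  have tr: "r (a, b) \<Longrightarrow> r (b, c) \<Longrightarrow> r (a, c)" for a b c
    using r unfolding strict_linear_order_on_def by (auto dest: transD)
  have tot: "a \<noteq> b \<Longrightarrow> r (a, b) \<or> r (b, a)" for a b
    using r unfolding strict_linear_order_on_def total_on_def by auto
  have "\<exists>m\<in>S. \<forall>h\<in>S. h \<noteq> m \<longrightarrow> r (h, m)" if "finite S" "S \<noteq> {}" for S
    using that
  proof (induction S rule: finite_ne_induct)
    case (insert a S)
    then obtain m where m: "m \<in> S" "\<forall>h\<in>S. h \<noteq> m \<longrightarrow> r (h, m)" by auto
    with insert.hyps have "a \<noteq> m" by auto
    then show ?case using m tot[of a m] tr by (metis insert_iff)
  qed auto
  then obtain m where m: "m \<in> F" "\<And>h. h \<in> F \<Longrightarrow> h \<noteq> m \<Longrightarrow> r (h, m)"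
    using Suc by (metis card.empty nat.distinct(1))
  let ?F = "F - {m}"
  \<comment> \<open>Removing the largest element leaves the initial segments of the others
    unchanged.\<close>
  have seg: "{h \<in> F. r (h, g)} = {h \<in> ?F. r (h, g)}" if "g \<in> ?F" for g
    using m that irr tr by blast
  have segm: "{h \<in> F. r (h, m)} = ?F" using m irr by auto
  have "(\<Sum>g\<in>?F. j (insert g {h \<in> F. r (h, g)}) - j {h \<in> F. r (h, g)}) = j ?F - j {}"
  proof -
    have "(\<Sum>g\<in>?F. j (insert g {h \<in> F. r (h, g)}) - j {h \<in> F. r (h, g)}) =
        (\<Sum>g\<in>?F. j (insert g {h \<in> ?F. r (h, g)}) - j {h \<in> ?F. r (h, g)})"
      by (rule sum.cong[OF refl]) (simp only: seg)
    also have "n = card ?F" using Suc.hyps(2) Suc.prems m(1) by simp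
    then have "(\<Sum>g\<in>?F. j (insert g {h \<in> ?F. r (h, g)}) - j {h \<in> ?F. r (h, g)}) = j ?F - j {}"
      using Suc.hyps(1)[of ?F] Suc.prems by blast
    finally show ?thesis .
  qed
  then show ?case
    using Suc.prems m(1) segm by (simp add: sum.remove[of F m] insert_absorb)
qed

text \<open>On a cell \<open>C\<close> the information is the constant
  \<open>- ln (measure M C)\<close>. The hypothesis \<open>c\<close> forces two cells that meet to
  coincide, and an empty cell contributes 0.\<close>

lemma (in prob_space) part_entropy_eq_integral_info:
  assumes R: "finite R" "R \<subseteq> sets M" "\<Union>R = space M"
    and c: "\<And>C x. C \<in> R \<Longrightarrow> x \<in> C \<Longrightarrow> cell M Z x = C"
  shows "part_entropy M R = (\<integral>x. info M Z x \<partial>M)" and "integrable M (info M Z)"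
proof -
  have e: "info M Z x = (\<Sum>C\<in>R. - ln (measure M C) * indicator C x)" if x: "x \<in> space M" for x
  proof -
    obtain C where C: "C \<in> R" "x \<in> C" using R(3) x by auto
    have "(\<Sum>D\<in>R. - ln (measure M D) * indicator D x) = (\<Sum>D\<in>R. if D = C then - ln (measure M C) else 0)"
      using c C by (intro sum.cong) (auto simp: indicator_def)
    then show ?thesis using C R(1) c[OF C] by (simp add: info_def)
  qed
  have Ri: "integrable M (\<lambda>x. - ln (measure M C) * indicator C x)" if "C \<in> R" for C
    using R(2) that by (auto simp: emeasure_eq_measure)
  have "(\<integral>x. info M Z x \<partial>M) = (\<integral>x. (\<Sum>C\<in>R. - ln (measure M C) * indicator C x) \<partial>M)"
    by (rule Bochner_Integration.integral_cong[OF refl e])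
  also have "\<dots> = (\<Sum>C\<in>R. (\<integral>x. - ln (measure M C) * indicator C x \<partial>M))"
    using Ri by (rule Bochner_Integration.integral_sum)
  also have "\<dots> = (\<Sum>C\<in>R. - (measure M C * ln (measure M C)))"
    using R(2) by (intro sum.cong refl) (auto simp: Int_absorb2 sets.sets_into_space subset_iff)
  finally show "part_entropy M R = (\<integral>x. info M Z x \<partial>M)"
    unfolding part_entropy_def by (simp add: sum_negf)
  show "integrable M (info M Z)"
    using Ri by (subst Bochner_Integration.integrable_cong[OF refl e]) auto
qed


section \<open>Relative entropy of an action with an equivariant order\<close>

text \<open>Made for two instances over the same factor \<open>Y\<close>: the group with its random
  order, and the integers acting by the successor map with their usual order. For the second
  instance the order is a separate map \<open>ord\<close>, constant in \<open>y\<close>, and the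
  action laws and equivariance are asked almost everywhere only.\<close>

locale ordered_action = prob_space M for M :: "'x measure" +
  fixes T :: "'g::group_add \<Rightarrow> 'x \<Rightarrow> 'x" and Y :: "'y measure" and \<phi> :: "'x \<Rightarrow> 'y"
    and \<tau> :: "'g \<Rightarrow> 'y \<Rightarrow> 'y" and ord :: "'y \<Rightarrow> 'g \<times> 'g \<Rightarrow> bool" and A :: "'x set"
  assumes countable_group: "countable (UNIV :: 'g set)"
    and T: "\<And>g. T g \<in> measurable M M" "\<And>g. distr M M (T g) = M"
    and T_add: "\<And>g h. AE x in M. T (g + h) x = T g (T h x)"
    and T_0: "AE x in M. T 0 x = x"
    and phi: "\<phi> \<in> measurable M Y"
    and tau: "\<And>g. \<tau> g \<in> measurable Y Y"
    and equivariant: "\<And>g. AE x in M. \<phi> (T g x) = \<tau> g (\<phi> x)"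
    and ord_strict: "\<And>y. y \<in> space Y \<Longrightarrow> strict_linear_order_on UNIV {p. ord y p}"
    and ord_measurable: "\<And>p. {y \<in> space Y. ord y p} \<in> sets Y"
    and ord_tau: "\<And>y g a b. y \<in> space Y \<Longrightarrow> ord (\<tau> g y) (a, b) \<longleftrightarrow> ord y (a + g, b + g)"
    and A: "A \<in> sets M"
begin

section \<open>Visit sets, generic points and codes of the past\<close>

definition visits :: "'x \<Rightarrow> 'g set" where
  "visits x = {g. T g x \<in> A}"

definition generic :: "'x \<Rightarrow> bool" where
  "generic x \<longleftrightarrow> (\<forall>g h. T (g + h) x = T g (T h x)) \<and> (\<forall>g. \<phi> (T g x) = \<tau> g (\<phi> x)) \<and> T 0 x = x"

text \<open>The code \<open>w\<close> of an order determines the finite piece \<open>d (w y)\<close> of the past of the unit.\<close>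

definition admissible :: "('y \<Rightarrow> 'w) \<Rightarrow> ('w \<Rightarrow> 'g set) \<Rightarrow> bool" where
  "admissible w d \<longleftrightarrow> discrete_rv Y w \<and> (\<forall>y\<in>space Y. finite (d (w y)) \<and> (\<forall>g\<in>d (w y). ord y (g, 0)))"

definition past_code :: "('y \<Rightarrow> 'w) \<Rightarrow> ('w \<Rightarrow> 'g set) \<Rightarrow> 'x \<Rightarrow> 'w \<times> 'g set" where
  "past_code w d x = (w (\<phi> x), visits x \<inter> d (w (\<phi> x)))"

definition past_entropy :: "('y \<Rightarrow> 'w) \<Rightarrow> ('w \<Rightarrow> 'g set) \<Rightarrow> real" where
  "past_entropy w d = (\<integral>x. cond_info M (\<lambda>x. 0 \<in> visits x) (past_code w d) x \<partial>M)"

text \<open>The substitute for the entropy of the present given the order and the whole past. The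
  value type of the codes has to be fixed in the definition; \<open>present_entropy_le\<close>
  extends the bound to all other value types.\<close>

definition present_entropy :: real where
  "present_entropy = Inf {past_entropy w d | (w :: 'y \<Rightarrow> nat) d. admissible w d}"

lemma phi_space: "x \<in> space M \<Longrightarrow> \<phi> x \<in> space Y"
  using measurable_space[OF phi] .

lemma tau_space: "y \<in> space Y \<Longrightarrow> \<tau> g y \<in> space Y"
  using measurable_space[OF tau] .

lemma T_space: "x \<in> space M \<Longrightarrow> T g x \<in> space M"
  using measurable_space[OF T(1)] .

lemma AE_generic: "AE x in M. generic x"
proof -
  note AE_all = AE_ball_countable[OF countable_group, unfolded ball_UNIV]
  have "AE x in M. \<forall>g h. T (g + h) x = T g (T h x)"
    unfolding AE_all using T_add by blast
  moreover have "AE x in M. \<forall>g. \<phi> (T g x) = \<tau> g (\<phi> x)"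
    unfolding AE_all using equivariant by blast
  ultimately show ?thesis unfolding generic_def using T_0 by auto
qed

lemma visits_T: "generic x \<Longrightarrow> visits (T g x) = {h. h + g \<in> visits x}"
  by (simp add: visits_def generic_def)

lemma visits_measurable: "{x \<in> space M. g \<in> visits x} \<in> sets M"
proof -
  have "{x \<in> space M. g \<in> visits x} = T g -` A \<inter> space M" by (auto simp: visits_def)
  then show ?thesis using measurable_sets[OF T(1) A] by simp
qed

lemma discrete_visit: "discrete_rv M (\<lambda>x. g \<in> visits x)"
  unfolding discrete_rv_def
proof (intro conjI ballI)
  fix x
  show "{y \<in> space M. (g \<in> visits y) = (g \<in> visits x)} \<in> sets M"
    using visits_measurable[of g] by (cases "g \<in> visits x") (auto intro: sets.sets_Collect_neg)
qed simp

lemma discrete_visits_Int: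
  assumes W: "discrete_rv M W" and fin: "\<And>x. x \<in> space M \<Longrightarrow> finite (D (W x))"
  shows "discrete_rv M (\<lambda>x. visits x \<inter> D (W x))"
proof (rule discrete_rv_finite_set[OF countable_group])
  fix g
  have "{x \<in> space M. g \<in> visits x \<inter> D (W x)} =
      {x \<in> space M. g \<in> visits x} \<inter> {x \<in> space M. g \<in> D (W x)}" by auto
  then show "{x \<in> space M. g \<in> visits x \<inter> D (W x)} \<in> sets M"
    using visits_measurable discrete_rv_pred[OF W, of "\<lambda>w. g \<in> D w"] by auto
qed (use fin in auto)

lemma discrete_visits: "finite F \<Longrightarrow> discrete_rv M (\<lambda>x. visits x \<inter> F)"
  using discrete_visits_Int[of "\<lambda>_. ()" "\<lambda>_. F"] by (simp add: discrete_rv_def)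

lemma discrete_phi: "discrete_rv Y w \<Longrightarrow> discrete_rv M (\<lambda>x. w (\<phi> x))"
  using discrete_rv_comp phi by metis

lemma discrete_past_code:
  assumes "admissible w d"
  shows "discrete_rv M (past_code w d)"
  unfolding past_code_def[abs_def]
  using assms phi_space unfolding admissible_def
  by (intro discrete_rv_Pair discrete_visits_Int discrete_phi) auto

text \<open>Two cases are used: \<open>a = 0\<close> gives the part of \<open>F\<close> below
  \<open>g\<close>, and \<open>g = 0\<close> gives a piece of the past of the unit, obtained by
  translating \<open>F\<close> so that \<open>a\<close> moves to the unit.\<close>

lemma discrete_segment: "finite F \<Longrightarrow> discrete_rv Y (\<lambda>y. {h. h + a \<in> F \<and> ord y (h, g)})"
proof (rule discrete_rv_finite_set[OF countable_group])
  fix y assume "finite F"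
  have "{h. h + a \<in> F \<and> ord y (h, g)} \<subseteq> (\<lambda>f. f - a) ` F"
    by (auto intro!: image_eqI[where x = "_ + a"] simp: add_diff_eq)
  with \<open>finite F\<close> show "finite {h. h + a \<in> F \<and> ord y (h, g)} \<and>
      {h. h + a \<in> F \<and> ord y (h, g)} \<subseteq> UNIV"
    using finite_subset by blast
next
  fix h
  show "{y \<in> space Y. h \<in> {h. h + a \<in> F \<and> ord y (h, g)}} \<in> sets Y"
    using ord_measurable[of "(h, g)"] by (cases "h + a \<in> F") auto
qed

lemma discrete_segment_visits:
  assumes F: "finite F"
  shows "discrete_rv M (\<lambda>x. visits x \<inter> {h \<in> F. ord (\<phi> x) (h, g)})"
proof -
  have "discrete_rv M (\<lambda>x. {h. h + 0 \<in> F \<and> ord (\<phi> x) (h, g)})"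
    by (rule discrete_phi[OF discrete_segment[OF F]])
  then have "discrete_rv M (\<lambda>x. {h \<in> F. ord (\<phi> x) (h, g)})" by simp
  from discrete_visits_Int[OF this, of "\<lambda>D. D"] F show ?thesis by simp
qed

lemma past_entropy_nonneg: "admissible w d \<Longrightarrow> 0 \<le> past_entropy w d"
  unfolding past_entropy_def by (intro integral_cond_info_nonneg discrete_visit discrete_past_code)

lemma admissible_trivial: "admissible (\<lambda>_. w) (\<lambda>_. {})"
  by (auto simp: admissible_def discrete_rv_def image_constant_conv)

section \<open>The infimum over pasts and its approximation by finite-valued codes\<close>

text \<open>Numbering the countably many values of \<open>w\<close> turns it into a code in
  \<open>nat\<close> that determines \<open>w\<close>; a finer code gives smaller past
  entropy.\<close>

lemma present_entropy_le:
  assumes wd: "admissible w d"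
  shows "present_entropy \<le> past_entropy w d"
proof -
  define e where "e = to_nat_on (w ` space Y)"
  define f where "f = from_nat_into (w ` space Y)"
  have c: "countable (w ` space Y)" using wd by (simp add: admissible_def discrete_rv_def)
  have fe: "f (e (w y)) = w y" if "y \<in> space Y" for y
    using c that by (simp add: e_def f_def)
  have adm: "admissible (\<lambda>y. e (w y)) (\<lambda>n. d (f n))"
    using wd fe unfolding admissible_def by (auto intro: discrete_rv_coarser[of Y w])
  have "past_entropy (\<lambda>y. e (w y)) (\<lambda>n. d (f n)) \<le> past_entropy w d"
    unfolding past_entropy_def
  proof (rule integral_cond_info_mono[OF discrete_visit _ discrete_past_code[OF wd] discrete_past_code[OF adm]])
    fix x y assume "x \<in> space M" "y \<in> space M"
      "past_code (\<lambda>y. e (w y)) (\<lambda>n. d (f n)) x = past_code (\<lambda>y. e (w y)) (\<lambda>n. d (f n)) y"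
    then show "past_code w d x = past_code w d y"
      using fe[OF phi_space] unfolding past_code_def by (metis (no_types, lifting) prod.inject)
  qed auto
  moreover have "bdd_below {past_entropy w d | (w :: 'y \<Rightarrow> nat) d. admissible w d}"
    using past_entropy_nonneg by (auto intro!: bdd_belowI[of _ 0])
  then have "present_entropy \<le> past_entropy (\<lambda>y. e (w y)) (\<lambda>n. d (f n))"
    unfolding present_entropy_def using adm by (intro cInf_lower) auto
  ultimately show ?thesis by simp
qed

lemma present_entropy_approx:
  assumes "0 < \<epsilon>"
  obtains w :: "'y \<Rightarrow> nat" and d where "admissible w d" "past_entropy w d < present_entropy + \<epsilon>"
proof -
  let ?S = "{past_entropy w d | (w :: 'y \<Rightarrow> nat) d. admissible w d}"
  have "past_entropy (\<lambda>_. 0 :: nat) (\<lambda>_. {}) \<in> ?S"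
    using admissible_trivial by (intro CollectI exI conjI) (rule refl)
  then have "?S \<noteq> {}" by (metis empty_iff)
  moreover have "bdd_below ?S"
    using past_entropy_nonneg by (auto intro!: bdd_belowI[of _ 0])
  ultimately have "\<exists>c\<in>?S. c < present_entropy + \<epsilon>"
    using assms cInf_less_iff[of ?S "present_entropy + \<epsilon>"] by (simp add: present_entropy_def)
  then show ?thesis using that by auto
qed

lemma ln_card_bool: "ln (real (card ((f :: 'x \<Rightarrow> bool) ` space M))) \<le> ln 2"
proof -
  have "card (f ` space M) \<le> card (UNIV :: bool set)" by (rule card_mono) auto
  moreover have "0 < card (f ` space M)" using not_empty by (simp add: card_gt_0_iff)
  ultimately show ?thesis by simp
qed

text \<open>Off a set of small measure that is seen by the truncated code, truncation does not change
  the information function.\<close>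

lemma truncate_code:
  fixes w :: "'y \<Rightarrow> nat"
  assumes wd: "admissible w d" and eps: "0 < \<epsilon>"
  obtains w' :: "'y \<Rightarrow> nat" and d' where "admissible w' d'" "finite (w' ` space Y)"
    "past_entropy w' d' \<le> past_entropy w d + \<epsilon>"
proof -
  let ?B = "\<lambda>n. {x \<in> space M. n < w (\<phi> x)}"
  have wY: "discrete_rv Y w" using wd by (simp add: admissible_def)
  have "?B n \<in> sets M" for n
    by (rule discrete_rv_pred[OF discrete_phi[OF wY]])
  then have "(\<lambda>n. measure M (?B n)) \<longlonglongrightarrow> measure M (\<Inter>n. ?B n)"
    by (intro finite_Lim_measure_decseq) (auto simp: decseq_def)
  also have "(\<Inter>n. ?B n) = {}" by auto
  finally have "(\<lambda>n. measure M (?B n)) \<longlonglongrightarrow> 0" by simp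
  from tendsto_mult_left_zero[OF this, of "ln 2"]
  have "eventually (\<lambda>n. measure M (?B n) * ln 2 < \<epsilon>) sequentially"
    using eps by (rule order_tendstoD(2))
  then obtain n where n: "measure M (?B n) * ln 2 < \<epsilon>"
    by (auto simp: eventually_sequentially)
  \<comment> \<open>All values above \<open>n\<close> are merged into \<open>Suc n\<close>, for
    which the past is dropped, so \<open>w'\<close> has finite range and remains admissible.\<close>
  define w' where "w' y = min (w y) (Suc n)" for y
  define d' where "d' k = (if k \<le> n then d k else {})" for k
  have adm: "admissible w' d'"
    using wd unfolding admissible_def
    by (auto simp: w'_def d'_def min_def intro: discrete_rv_coarser[of Y w])
  have "w' ` space Y \<subseteq> {..Suc n}" by (auto simp: w'_def)
  then have fin: "finite (w' ` space Y)" using finite_subset by blast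
  let ?L = "\<lambda>x. 0 \<in> visits x"
  let ?Z = "past_code w d" and ?Z' = "past_code w' d'"
  let ?b = "\<lambda>z. fst z = Suc n"
  note Z = discrete_past_code[OF wd] and Z' = discrete_past_code[OF adm]
  have finL: "finite (?L ` space M)" by simp
  have iZ: "integrable M (cond_info M ?L ?Z)" and iZ': "integrable M (cond_info M ?L ?Z')"
    using cond_info_bound(1)[OF discrete_visit finL] Z Z' by auto
  have bm: "{x \<in> space M. b (?Z' x)} \<in> sets M" for b
    by (rule discrete_rv_pred[OF Z'])
  have ib: "integrable M (\<lambda>x. of_bool (b (?Z' x)) * cond_info M ?L ?Z' x)" for b
  proof -
    have "integrable M (\<lambda>x. indicator {x \<in> space M. b (?Z' x)} x * cond_info M ?L ?Z' x)"
      using integrable_real_mult_indicator[OF bm iZ'] by (simp add: mult.commute)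
    then show ?thesis
      by (rule Bochner_Integration.integrable_cong[THEN iffD1, rotated 2]) auto
  qed
  have same: "cond_info M ?L ?Z' x = cond_info M ?L ?Z x" if "x \<in> space M" "\<not> ?b (?Z' x)" for x
  proof -
    have x: "w (\<phi> x) \<le> n" using that(2) by (auto simp: past_code_def w'_def)
    have eq: "?Z' y = ?Z' x \<longleftrightarrow> ?Z y = ?Z x" for y
      using x by (auto simp: past_code_def w'_def d'_def min_def)
    show ?thesis
      unfolding cond_info_def using eq by (simp add: info_cong[of M ?Z' x ?Z]
        info_cong[of M "\<lambda>y. (?L y, ?Z' y)" x "\<lambda>y. (?L y, ?Z y)"])
  qed
  have "(\<integral>x. cond_info M ?L ?Z' x \<partial>M) =
     (\<integral>x. of_bool (?b (?Z' x)) * cond_info M ?L ?Z' x + of_bool (\<not> ?b (?Z' x)) * cond_info M ?L ?Z' x \<partial>M)"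
    by (intro Bochner_Integration.integral_cong) auto
  also have "\<dots> = (\<integral>x. of_bool (?b (?Z' x)) * cond_info M ?L ?Z' x \<partial>M) +
      (\<integral>x. of_bool (\<not> ?b (?Z' x)) * cond_info M ?L ?Z' x \<partial>M)"
    by (rule Bochner_Integration.integral_add[OF ib ib])
  also have "(\<integral>x. of_bool (\<not> ?b (?Z' x)) * cond_info M ?L ?Z' x \<partial>M) \<le> (\<integral>x. cond_info M ?L ?Z x \<partial>M)"
  proof (rule integral_mono_AE[OF ib iZ])
    show "AE x in M. of_bool (\<not> ?b (?Z' x)) * cond_info M ?L ?Z' x \<le> cond_info M ?L ?Z x"
      using AE_space cond_info_nonneg[OF discrete_visit[of 0] Z]
    proof eventually_elim
      case (elim x)
      then show ?case using same[of x] by (cases "?b (?Z' x)") simp_all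
    qed
  qed
  \<comment> \<open>On the merged fibre the event costs at most \<open>ln 2\<close> per unit of
    measure, and \<open>n\<close> was chosen to make that measure small.\<close>
  also have "(\<integral>x. of_bool (?b (?Z' x)) * cond_info M ?L ?Z' x \<partial>M) \<le> measure M {x \<in> space M. ?b (?Z' x)} * ln 2"
    by (rule order_trans[OF cond_info_bound(2)[OF discrete_visit finL Z'] mult_left_mono[OF ln_card_bool]]) simp
  also have "{x \<in> space M. ?b (?Z' x)} = ?B n"
    by (auto simp: past_code_def w'_def min_def)
  finally have "past_entropy w' d' \<le> past_entropy w d + \<epsilon>"
    unfolding past_entropy_def using n by simp
  with adm fin show ?thesis by (rule that)
qed

section \<open>The chain rule along the order and bounds for its terms\<close>

text \<open>The hypothesis makes \<open>Q\<close> determine the order on \<open>F\<close>, so on the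
  fibre of \<open>Q\<close> through \<open>x\<close> every initial segment of \<open>F\<close> is
  constant. The logarithms of the successive fibres then telescope along the order at
  \<open>x\<close>.\<close>

lemma cond_info_visits_eq_sum:
  assumes F: "finite F" and x: "x \<in> space M"
    and Q: "\<And>x y p. x \<in> space M \<Longrightarrow> y \<in> space M \<Longrightarrow> Q x = Q y \<Longrightarrow> p \<in> F \<times> F \<Longrightarrow> ord (\<phi> x) p \<longleftrightarrow> ord (\<phi> y) p"
  shows "cond_info M (\<lambda>x. visits x \<inter> F) Q x =
     (\<Sum>g\<in>F. cond_info M (\<lambda>x. g \<in> visits x) (\<lambda>x. (Q x, visits x \<inter> {h \<in> F. ord (\<phi> x) (h, g)})) x)"
proof -
  \<comment> \<open>The information at \<open>x\<close> of \<open>Q\<close> together with the visits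
    in \<open>C\<close>, where \<open>C\<close> is held fixed while \<open>y\<close> varies.\<close>
  define j where "j C = - ln (measure M {y \<in> space M. Q y = Q x \<and> visits y \<inter> C = visits x \<inter> C})" for C
  have same: "{h \<in> F. ord (\<phi> y) (h, g)} = {h \<in> F. ord (\<phi> x) (h, g)}"
    if "y \<in> space M" "Q y = Q x" "g \<in> F" for y g
    using Q[OF that(1) x that(2)] that(3) by auto
  have step: "cond_info M (\<lambda>x. g \<in> visits x) (\<lambda>x. (Q x, visits x \<inter> {h \<in> F. ord (\<phi> x) (h, g)})) x =
      j (insert g {h \<in> F. ord (\<phi> x) (h, g)}) - j {h \<in> F. ord (\<phi> x) (h, g)}" if g: "g \<in> F" for g
  proof -
    have "{y \<in> space M. (Q y, visits y \<inter> {h \<in> F. ord (\<phi> y) (h, g)}) = (Q x, visits x \<inter> {h \<in> F. ord (\<phi> x) (h, g)})}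
       = {y \<in> space M. Q y = Q x \<and> visits y \<inter> {h \<in> F. ord (\<phi> x) (h, g)} = visits x \<inter> {h \<in> F. ord (\<phi> x) (h, g)}}"
      using same[OF _ _ g] by auto
    moreover have "{y \<in> space M. (g \<in> visits y, Q y, visits y \<inter> {h \<in> F. ord (\<phi> y) (h, g)}) =
         (g \<in> visits x, Q x, visits x \<inter> {h \<in> F. ord (\<phi> x) (h, g)})}
       = {y \<in> space M. Q y = Q x \<and> visits y \<inter> insert g {h \<in> F. ord (\<phi> x) (h, g)} = visits x \<inter> insert g {h \<in> F. ord (\<phi> x) (h, g)}}"
      (is "?l = ?r")
    proof (rule Collect_cong, rule conj_cong[OF refl])
      fix y assume y: "y \<in> space M"
      let ?C = "{h \<in> F. ord (\<phi> x) (h, g)}"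
      have "g \<notin> ?C" using ord_strict[OF phi_space[OF x]] by (auto simp: strict_linear_order_on_def irrefl_def)
      then have "visits y \<inter> insert g ?C = visits x \<inter> insert g ?C \<longleftrightarrow>
        (g \<in> visits y \<longleftrightarrow> g \<in> visits x) \<and> visits y \<inter> ?C = visits x \<inter> ?C"
        by blast
      with same[OF y _ g] show "((g \<in> visits y, Q y, visits y \<inter> {h \<in> F. ord (\<phi> y) (h, g)}) =
         (g \<in> visits x, Q x, visits x \<inter> {h \<in> F. ord (\<phi> x) (h, g)})) =
         (Q y = Q x \<and> visits y \<inter> insert g ?C = visits x \<inter> insert g ?C)" by auto
    qed
    ultimately show ?thesis unfolding cond_info_def info_def cell_def j_def by simp
  qed
  have "{y \<in> space M. (visits y \<inter> F, Q y) = (visits x \<inter> F, Q x)} =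
      {y \<in> space M. Q y = Q x \<and> visits y \<inter> F = visits x \<inter> F}" by auto
  then have "cond_info M (\<lambda>x. visits x \<inter> F) Q x = j F - j {}"
    unfolding cond_info_def info_def cell_def j_def by simp
  also have "\<dots> = (\<Sum>g\<in>F. j (insert g {h \<in> F. ord (\<phi> x) (h, g)}) - j {h \<in> F. ord (\<phi> x) (h, g)})"
    using sum_initial_segments[OF ord_strict[OF phi_space[OF x]] F] by simp
  finally show ?thesis using step by simp
qed

definition visit_entropy :: "('y \<Rightarrow> 'q) \<Rightarrow> 'g set \<Rightarrow> 'g \<Rightarrow> real" where
  "visit_entropy q F g =
     (\<integral>x. cond_info M (\<lambda>x. g \<in> visits x) (\<lambda>x. (q (\<phi> x), visits x \<inter> {h \<in> F. ord (\<phi> x) (h, g)})) x \<partial>M)"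

lemma integral_cond_info_visits:
  assumes F: "finite F" and q: "discrete_rv Y q"
    and ord: "\<And>y z p. y \<in> space Y \<Longrightarrow> z \<in> space Y \<Longrightarrow> q y = q z \<Longrightarrow> p \<in> F \<times> F \<Longrightarrow> ord y p \<longleftrightarrow> ord z p"
  shows "(\<integral>x. cond_info M (\<lambda>x. visits x \<inter> F) (\<lambda>x. q (\<phi> x)) x \<partial>M) = (\<Sum>g\<in>F. visit_entropy q F g)"
proof -
  have "(\<integral>x. cond_info M (\<lambda>x. visits x \<inter> F) (\<lambda>x. q (\<phi> x)) x \<partial>M) = (\<integral>x. (\<Sum>g\<in>F.
     cond_info M (\<lambda>x. g \<in> visits x) (\<lambda>x. (q (\<phi> x), visits x \<inter> {h \<in> F. ord (\<phi> x) (h, g)})) x) \<partial>M)"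
    by (intro Bochner_Integration.integral_cong refl cond_info_visits_eq_sum[OF F])
       (use ord phi_space in blast)+
  also have "\<dots> = (\<Sum>g\<in>F. visit_entropy q F g)"
    unfolding visit_entropy_def
    by (intro Bochner_Integration.integral_sum cond_info_bound(1) discrete_visit discrete_rv_Pair
        discrete_phi q discrete_segment_visits F) simp
  finally show ?thesis .
qed

text \<open>Translating by \<open>- g\<close> moves \<open>g\<close> to the unit. By invariance the
  term becomes the entropy of the present given a translated history, and some admissible past code
  is at least as fine as that history.\<close>

lemma visit_entropy_ge:
  assumes F: "finite F" and q: "discrete_rv Y q"
  shows "present_entropy \<le> visit_entropy q F g"
proof -
  let ?Z = "\<lambda>x. (q (\<phi> x), visits x \<inter> {h \<in> F. ord (\<phi> x) (h, g)})"
  let ?S = "\<lambda>y. {h. h + g \<in> F \<and> ord y (h, 0)}"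
  \<comment> \<open>The code keeps \<open>q\<close> of the translated order and the finite piece of
    the past itself, so \<open>snd\<close> reads the piece off.\<close>
  define w where "w y = (q (\<tau> (- g) y), ?S y)" for y
  have Z: "discrete_rv M ?Z"
    by (intro discrete_rv_Pair discrete_phi q discrete_segment_visits F)
  have "finite (?S y)" for y
  proof (rule finite_subset)
    show "?S y \<subseteq> (\<lambda>f. f - g) ` F"
      by (auto intro!: image_eqI[where x = "_ + g"] simp: add_diff_eq)
  qed (use F in simp)
  then have adm: "admissible w snd"
    unfolding admissible_def w_def[abs_def]
    by (intro conjI ballI discrete_rv_Pair discrete_rv_comp[OF q tau] discrete_segment[OF F]) auto
  have "present_entropy \<le> past_entropy w snd" by (rule present_entropy_le[OF adm])
  also have "\<dots> \<le> (\<integral>x. cond_info M (\<lambda>x. 0 \<in> visits x) (\<lambda>x. ?Z (T (- g) x)) x \<partial>M)"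
    unfolding past_entropy_def
  proof (rule integral_cond_info_mono[OF discrete_visit _ discrete_rv_comp[OF Z T(1)]
        discrete_past_code[OF adm] AE_generic])
    fix x y assume x: "x \<in> space M" and y: "y \<in> space M" and gx: "generic x" and gy: "generic y"
      and eq: "past_code w snd x = past_code w snd y"
    \<comment> \<open>The history of \<open>g\<close> at \<open>T (- g) z\<close> is the right
      translate by \<open>g\<close> of the visits of \<open>z\<close> in that piece of the
      past.\<close>
    have seg: "visits (T (- g) z) \<inter> {h \<in> F. ord (\<phi> (T (- g) z)) (h, g)} =
        {k. k - g \<in> visits z \<inter> snd (w (\<phi> z))}" if "z \<in> space M" "generic z" for z
    proof -
      have "\<phi> (T (- g) z) = \<tau> (- g) (\<phi> z)" using that by (simp add: generic_def)
      then show ?thesis using that(1)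
        by (auto simp: visits_T[OF that(2)] ord_tau phi_space w_def)
    qed
    have w: "w (\<phi> x) = w (\<phi> y)"
      using eq unfolding past_code_def prod.inject by (rule conjunct1)
    have v: "visits x \<inter> snd (w (\<phi> x)) = visits y \<inter> snd (w (\<phi> y))"
      using eq unfolding past_code_def prod.inject by (rule conjunct2)
    have "q (\<phi> (T (- g) x)) = q (\<phi> (T (- g) y))"
      using w gx gy unfolding w_def generic_def by (simp only: prod.inject)
    then show "?Z (T (- g) x) = ?Z (T (- g) y)"
      unfolding seg[OF x gx] seg[OF y gy] v by simp
  qed simp
  also have "\<dots> = (\<integral>x. cond_info M (\<lambda>x. g \<in> visits (T (- g) x)) (\<lambda>x. ?Z (T (- g) x)) x \<partial>M)"
    using AE_generic
    by (intro integral_cond_info_cong discrete_visit discrete_rv_comp[OF discrete_visit T(1)]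
        discrete_rv_comp[OF Z T(1)]) (auto elim!: eventually_mono simp: visits_T)
  also have "\<dots> = visit_entropy q F g"
    unfolding visit_entropy_def
    by (rule integral_cond_info_comp[OF T discrete_visit Z])
  finally show ?thesis .
qed

text \<open>By \<open>w\<close> and \<open>d\<close>, the code \<open>q\<close> and the history of
  \<open>g\<close> inside \<open>F\<close> determine the past code at \<open>T g x\<close>: the
  translate by \<open>g\<close> of the piece of the past lies in \<open>F\<close>. Conditioning on
  less increases entropy, and invariance moves \<open>g\<close> back to the unit.\<close>

lemma visit_entropy_le:
  assumes F: "finite F" and q: "discrete_rv Y q" and wd: "admissible w d"
    and w: "\<And>y z. y \<in> space Y \<Longrightarrow> z \<in> space Y \<Longrightarrow> q y = q z \<Longrightarrow> w (\<tau> g y) = w (\<tau> g z)"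
    and d: "\<And>y k. y \<in> space Y \<Longrightarrow> k \<in> d (w y) \<Longrightarrow> k + g \<in> F"
  shows "visit_entropy q F g \<le> past_entropy w d"
proof -
  let ?Z = "\<lambda>x. (q (\<phi> x), visits x \<inter> {h \<in> F. ord (\<phi> x) (h, g)})"
  note P = discrete_past_code[OF wd]
  have Z: "discrete_rv M ?Z"
    by (intro discrete_rv_Pair discrete_phi q discrete_segment_visits F)
  have "visit_entropy q F g \<le> (\<integral>x. cond_info M (\<lambda>x. g \<in> visits x) (\<lambda>x. past_code w d (T g x)) x \<partial>M)"
    unfolding visit_entropy_def
  proof (rule integral_cond_info_mono[OF discrete_visit _ discrete_rv_comp[OF P T(1)] Z AE_generic])
    fix x y assume x: "x \<in> space M" and y: "y \<in> space M" and gx: "generic x" and gy: "generic y"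
      and eq: "?Z x = ?Z y"
    \<comment> \<open>Defined at \<open>x\<close>, but it is the same piece of the past at
      \<open>y\<close>, since \<open>q\<close> agrees at both points.\<close>
    define D where "D = d (w (\<tau> g (\<phi> x)))"
    have ww: "w (\<tau> g (\<phi> x)) = w (\<tau> g (\<phi> y))" using eq w phi_space x y by auto
    have D: "h + g \<in> visits z \<longleftrightarrow> h + g \<in> visits z \<inter> {h \<in> F. ord (\<phi> z) (h, g)}"
      if "h \<in> D" "z \<in> {x, y}" for h z
    proof -
      have z: "\<phi> z \<in> space Y" using that(2) x y phi_space by auto
      have h: "h \<in> d (w (\<tau> g (\<phi> z)))" using that ww by (auto simp: D_def)
      then have "ord (\<tau> g (\<phi> z)) (h, 0)"
        using wd tau_space[OF z] unfolding admissible_def by auto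
      then show ?thesis using d[OF tau_space[OF z] h] ord_tau[OF z] by simp
    qed
    have "visits (T g x) \<inter> D = visits (T g y) \<inter> D"
      using D eq by (auto simp: visits_T gx gy)
    then show "past_code w d (T g x) = past_code w d (T g y)"
      using gx gy ww by (simp add: past_code_def generic_def D_def)
  qed simp
  also have "\<dots> = (\<integral>x. cond_info M (\<lambda>x. 0 \<in> visits (T g x)) (\<lambda>x. past_code w d (T g x)) x \<partial>M)"
    using AE_generic
    by (intro integral_cond_info_cong discrete_visit discrete_rv_comp[OF discrete_visit T(1)]
        discrete_rv_comp[OF P T(1)]) (auto elim!: eventually_mono simp: visits_T)
  also have "\<dots> = past_entropy w d"
    unfolding past_entropy_def
    by (rule integral_cond_info_comp[OF T discrete_visit P])
  finally show ?thesis .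
qed

lemma visit_entropy_le_ln2:
  assumes F: "finite F" and q: "discrete_rv Y q"
  shows "visit_entropy q F g \<le> ln 2"
proof -
  let ?Z = "\<lambda>x. (q (\<phi> x), visits x \<inter> {h \<in> F. ord (\<phi> x) (h, g)})"
  have Z: "discrete_rv M ?Z"
    by (intro discrete_rv_Pair discrete_phi q discrete_segment_visits F)
  have "finite ((\<lambda>x. g \<in> visits x) ` space M)" by simp
  from cond_info_bound(2)[OF discrete_visit this Z, of "\<lambda>_. True"]
  show ?thesis unfolding visit_entropy_def using ln_card_bool[of "\<lambda>x. g \<in> visits x"]
    by (simp add: prob_space)
qed

section \<open>Translation between partitions and codes\<close>

abbreviation "orbit_partition \<equiv> orbit_join M T {A, space M - A}"

abbreviation "factor_algebra \<equiv> {\<phi> -` B \<inter> space M | B. B \<in> sets Y}"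

lemma orbit_partition_cell:
  assumes "C \<in> orbit_partition F" "x \<in> C"
  shows "C = {y \<in> space M. visits y \<inter> F = visits x \<inter> F}"
proof -
  obtain p where p: "p \<in> F \<rightarrow>\<^sub>E {A, space M - A}" and C: "C = {x \<in> space M. \<forall>g\<in>F. T g x \<in> p g}"
    using assms(1) by (auto simp: orbit_join_def)
  have x: "x \<in> space M" "\<And>g. g \<in> F \<Longrightarrow> T g x \<in> p g" using assms(2) C by auto
  have "T g y \<in> p g \<longleftrightarrow> (T g y \<in> A \<longleftrightarrow> T g x \<in> A)" if "g \<in> F" "y \<in> space M" for g y
    using x(2)[OF that(1)] PiE_mem[OF p that(1)] T_space[OF that(2), of g] by auto
  then show ?thesis unfolding C by (auto simp: visits_def)
qed

lemma orbit_partition: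
  assumes F: "finite F"
  shows "finite (orbit_partition F)" "orbit_partition F \<subseteq> sets M" "\<Union>(orbit_partition F) = space M"
proof -
  show "finite (orbit_partition F)"
    unfolding orbit_join_def using F by (auto simp: Setcompr_eq_image intro!: finite_PiE)
  have "C \<in> sets M" if C: "C \<in> orbit_partition F" for C
  proof (cases "C = {}")
    case False
    then obtain x where "x \<in> C" by auto
    show ?thesis
      unfolding orbit_partition_cell[OF C \<open>x \<in> C\<close>] by (rule discrete_rv_fibre[OF discrete_visits[OF F]])
  qed simp
  then show "orbit_partition F \<subseteq> sets M" by auto
  show "\<Union>(orbit_partition F) = space M"
  proof (intro set_eqI iffI)
    fix x assume x: "x \<in> space M"
    let ?p = "\<lambda>g\<in>F. if T g x \<in> A then A else space M - A"
    have "?p \<in> F \<rightarrow>\<^sub>E {A, space M - A}" by auto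
    then have "{y \<in> space M. \<forall>g\<in>F. T g y \<in> ?p g} \<in> orbit_partition F"
      unfolding orbit_join_def by blast
    moreover have "x \<in> {y \<in> space M. \<forall>g\<in>F. T g y \<in> ?p g}"
      using x T_space by auto
    ultimately show "x \<in> \<Union>(orbit_partition F)" by blast
  qed (auto simp: orbit_join_def)
qed

lemma finite_range_visits: "finite F \<Longrightarrow> finite ((\<lambda>x. visits x \<inter> F) ` space M)"
  by (rule finite_subset[of _ "Pow F"]) auto

text \<open>Nonempty cells of the join are the fibres of the pair of codes, so the difference of
  entropies is the integral of a difference of information functions.\<close>

lemma part_entropy_join_diff:
  assumes F: "finite F" and Q: "fin_partition M Q"
    and c: "\<And>C x. C \<in> Q \<Longrightarrow> x \<in> C \<Longrightarrow> cell M q x = C"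
  shows "part_entropy M (join (orbit_partition F) Q) - part_entropy M Q =
    (\<integral>x. cond_info M (\<lambda>x. visits x \<inter> F) q x \<partial>M)"
proof -
  let ?J = "join (orbit_partition F) Q"
  have Q': "finite Q" "Q \<subseteq> sets M" "\<Union>Q = space M" using Q by (auto simp: fin_partition_def)
  note O = orbit_partition[OF F]
  have J_eq: "?J = (\<lambda>(A, B). A \<inter> B) ` (orbit_partition F \<times> Q)"
    by (auto simp: join_def)
  have J: "finite ?J" "?J \<subseteq> sets M"
    using Q' O unfolding J_eq by auto
  have "\<Union>?J = \<Union>(orbit_partition F) \<inter> \<Union>Q"
    unfolding J_eq by auto
  then have J3: "\<Union>?J = space M" using O(3) Q'(3) by simp
  have cJ: "cell M (\<lambda>y. (visits y \<inter> F, q y)) x = D" if D: "D \<in> ?J" "x \<in> D" for D x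
  proof -
    obtain B C where B: "B \<in> orbit_partition F" and C: "C \<in> Q" and DBC: "D = B \<inter> C"
      using D(1) by (auto simp: join_def)
    have x: "x \<in> B" "x \<in> C" using D(2) DBC by auto
    have "cell M (\<lambda>y. (visits y \<inter> F, q y)) x = {y \<in> space M. visits y \<inter> F = visits x \<inter> F} \<inter> cell M q x"
      by (auto simp: cell_def)
    also have "\<dots> = B \<inter> C" using orbit_partition_cell[OF B x(1)] c[OF C x(2)] by simp
    finally show ?thesis using DBC by simp
  qed
  have "part_entropy M ?J - part_entropy M Q = (\<integral>x. info M (\<lambda>y. (visits y \<inter> F, q y)) x \<partial>M) - (\<integral>x. info M q x \<partial>M)"
    using part_entropy_eq_integral_info(1)[OF J J3 cJ] part_entropy_eq_integral_info(1)[OF Q' c] by simp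
  also have "\<dots> = (\<integral>x. info M (\<lambda>y. (visits y \<inter> F, q y)) x - info M q x \<partial>M)"
    using part_entropy_eq_integral_info(2)[OF J J3 cJ] part_entropy_eq_integral_info(2)[OF Q' c]
    by (intro Bochner_Integration.integral_diff[symmetric]) auto
  finally show ?thesis unfolding cond_info_def .
qed

lemma partition_from_factor:
  assumes Q: "fin_partition M Q" "Q \<subseteq> factor_algebra"
  obtains q :: "'y \<Rightarrow> 'x set set" where "discrete_rv Y q"
    "\<And>C x. C \<in> Q \<Longrightarrow> x \<in> C \<Longrightarrow> cell M (\<lambda>x. q (\<phi> x)) x = C"
proof -
  have "\<forall>C\<in>Q. \<exists>B. B \<in> sets Y \<and> C = \<phi> -` B \<inter> space M" using Q(2) by auto
  then obtain B where B: "\<And>C. C \<in> Q \<Longrightarrow> B C \<in> sets Y" "\<And>C. C \<in> Q \<Longrightarrow> C = \<phi> -` B C \<inter> space M"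
    by metis
  \<comment> \<open>The sets \<open>B C\<close> may overlap outside the image of
    \<open>\<phi>\<close>, so \<open>q\<close> records all cells whose set contains
    \<open>y\<close>; at \<open>\<phi> x\<close> exactly one cell is left.\<close>
  define q where "q y = {C \<in> Q. y \<in> B C}" for y
  have finQ: "finite Q" and disj: "\<And>C D. C \<in> Q \<Longrightarrow> D \<in> Q \<Longrightarrow> C \<inter> D \<noteq> {} \<Longrightarrow> C = D"
    using Q(1) by (auto simp: fin_partition_def disjoint_def)
  have "discrete_rv Y q"
  proof (rule discrete_rv_finite_set[OF countable_finite[OF finQ]])
    fix C assume C: "C \<in> Q"
    then have "{y \<in> space Y. C \<in> q y} = B C"
      using sets.sets_into_space[OF B(1)[OF C]] by (auto simp: q_def)
    then show "{y \<in> space Y. C \<in> q y} \<in> sets Y" using B(1)[OF C] by simp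
  qed (use finQ in \<open>auto simp: q_def\<close>)
  moreover have "cell M (\<lambda>x. q (\<phi> x)) x = C" if C: "C \<in> Q" "x \<in> C" for C x
  proof -
    have iff: "D \<in> q (\<phi> y) \<longleftrightarrow> D \<in> Q \<and> y \<in> D" if "y \<in> space M" for y D
      using B(2)[of D] that by (auto simp: q_def)
    have sp: "C \<subseteq> space M" using B(2)[OF C(1)] by auto
    have qC: "q (\<phi> y) = {C}" if "y \<in> C" for y
      using iff[of y] that sp C(1) disj by blast
    show ?thesis
    proof (intro set_eqI iffI)
      fix y assume "y \<in> cell M (\<lambda>x. q (\<phi> x)) x"
      then show "y \<in> C" using qC[OF C(2)] iff[of y C] by (auto simp: cell_def)
    qed (use qC C sp in \<open>auto simp: cell_def\<close>)
  qed
  ultimately show ?thesis by (rule that)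
qed

text \<open>Joined to a conditioning code, this supplies the knowledge of the order on
  \<open>F\<close> that the chain rule requires.\<close>

definition order_code :: "'g set \<Rightarrow> 'y \<Rightarrow> ('g \<times> 'g) set" where
  "order_code F y = {p \<in> F \<times> F. ord y p}"

lemma discrete_order_code: "finite F \<Longrightarrow> discrete_rv Y (order_code F)"
proof (rule discrete_rv_finite_set[where U = "F \<times> F"])
  fix p assume "p \<in> F \<times> F"
  then show "{y \<in> space Y. p \<in> order_code F y} \<in> sets Y"
    using ord_measurable[of p] by (simp add: order_code_def)
qed (auto simp: order_code_def intro: countable_finite)

lemma order_code_eq: "order_code F y = order_code F z \<Longrightarrow> p \<in> F \<times> F \<Longrightarrow> ord y p \<longleftrightarrow> ord z p"
  unfolding order_code_def by blast

section \<open>Two-sided bounds for the entropy along a finite set, and the Folner limit\<close>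

text \<open>Refining \<open>Q\<close> by the order on \<open>F\<close> can only lower the
  conditional entropy; afterwards the chain rule applies and each of its terms is at least
  \<open>present_entropy\<close>.\<close>

lemma conditional_entropy_ge:
  assumes F: "finite F" and Q: "fin_partition M Q" "Q \<subseteq> factor_algebra"
  shows "card F * present_entropy \<le> part_entropy M (join (orbit_partition F) Q) - part_entropy M Q"
proof -
  obtain q :: "'y \<Rightarrow> 'x set set" where q: "discrete_rv Y q"
    "\<And>C x. C \<in> Q \<Longrightarrow> x \<in> C \<Longrightarrow> cell M (\<lambda>x. q (\<phi> x)) x = C"
    by (rule partition_from_factor[OF Q]) blast
  let ?q = "\<lambda>y. (q y, order_code F y)"
  have dq: "discrete_rv Y ?q" by (intro discrete_rv_Pair q discrete_order_code F)
  have "card F * present_entropy \<le> (\<Sum>g\<in>F. visit_entropy ?q F g)"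
    using visit_entropy_ge[OF F dq] by (rule sum_bounded_below)
  also have "\<dots> = (\<integral>x. cond_info M (\<lambda>x. visits x \<inter> F) (\<lambda>x. ?q (\<phi> x)) x \<partial>M)"
    by (rule integral_cond_info_visits[OF F dq, symmetric]) (auto dest: order_code_eq)
  also have "\<dots> \<le> (\<integral>x. cond_info M (\<lambda>x. visits x \<inter> F) (\<lambda>x. q (\<phi> x)) x \<partial>M)"
    by (rule integral_cond_info_mono[OF discrete_visits[OF F] finite_range_visits[OF F]
          discrete_phi[OF q(1)] discrete_phi[OF dq], where E = "\<lambda>_. True"]) auto
  also have "\<dots> = part_entropy M (join (orbit_partition F) Q) - part_entropy M Q"
    using part_entropy_join_diff[OF F Q(1) q(2)] by simp
  finally show ?thesis .
qed

lemma rel_part_entropy_ge: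
  assumes F: "finite F"
  shows "card F * present_entropy \<le> rel_part_entropy M (orbit_partition F) factor_algebra"
  unfolding rel_part_entropy_def
proof (rule cINF_greatest)
  have "fin_partition M {space M}" by (simp add: fin_partition_def)
  moreover have "space M = \<phi> -` space Y \<inter> space M" using phi_space by auto
  then have "{space M} \<subseteq> factor_algebra" by blast
  ultimately show "{Q. fin_partition M Q \<and> Q \<subseteq> factor_algebra} \<noteq> {}" by blast
qed (use conditional_entropy_ge[OF F] in auto)

text \<open>The fibres of a finite-valued code on \<open>Y\<close> pull back to one of the
  partitions in the infimum. Boundedness below, required for an infimum of reals, comes from
  \<open>conditional_entropy_ge\<close>.\<close>

lemma rel_part_entropy_le:
  assumes F: "finite F" and q: "discrete_rv Y q" "finite (q ` space Y)"
  shows "rel_part_entropy M (orbit_partition F) factor_algebra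
     \<le> (\<integral>x. cond_info M (\<lambda>x. visits x \<inter> F) (\<lambda>x. q (\<phi> x)) x \<partial>M)"
proof -
  define Q where "Q = (\<lambda>v. \<phi> -` {y \<in> space Y. q y = v} \<inter> space M) ` (q ` space Y)"
  have "\<phi> -` {y \<in> space Y. q y = v} \<inter> space M \<in> sets M" for v
    using measurable_sets[OF phi discrete_rv_fibre[OF q(1)]] .
  then have Q: "fin_partition M Q"
    using q(2) phi_space unfolding fin_partition_def Q_def by (auto simp: disjoint_def)
  have sub: "Q \<subseteq> factor_algebra"
    using discrete_rv_fibre[OF q(1)] unfolding Q_def by blast
  have c: "cell M (\<lambda>x. q (\<phi> x)) x = C" if "C \<in> Q" "x \<in> C" for C x
    using that phi_space by (auto simp: Q_def cell_def)
  have "rel_part_entropy M (orbit_partition F) factor_algebra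
     \<le> part_entropy M (join (orbit_partition F) Q) - part_entropy M Q"
    unfolding rel_part_entropy_def
    using Q sub conditional_entropy_ge[OF F] by (intro cINF_lower bdd_belowI2) auto
  then show ?thesis using part_entropy_join_diff[OF F Q c] by simp
qed

text \<open>The conditioning code records the order on \<open>F\<close> and the value of
  \<open>w\<close> seen from every \<open>g\<close> in \<open>F\<close>. If all possible pieces of
  the past, translated by \<open>g\<close>, stay inside \<open>F\<close>, then the term of
  \<open>g\<close> is at most \<open>past_entropy w d\<close>; the other terms cost at most
  \<open>ln 2\<close> each and are counted by the Folner defects.\<close>

lemma rel_part_entropy_upper:
  fixes w :: "'y \<Rightarrow> 'w"
  assumes F: "finite F" and wd: "admissible w d" and fin: "finite (w ` space Y)"
  shows "rel_part_entropy M (orbit_partition F) factor_algebra \<le>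
    card F * past_entropy w d +
    (\<Sum>k\<in>(\<Union>y\<in>space Y. d (w y)). real (card F) - card (F \<inter> (\<lambda>h. - k + h) ` F)) * ln 2"
proof -
  let ?K = "\<Union>y\<in>space Y. d (w y)"
  have "?K = (\<Union>v\<in>w ` space Y. d v)" by auto
  then have K: "finite ?K" using finite_UN_I[OF fin, of d] wd by (auto simp: admissible_def)
  \<comment> \<open>The graph over \<open>F\<close> of the map from \<open>g\<close> to the code
    seen from \<open>g\<close>, stored as a finite set.\<close>
  define s where "s y = {(g, k). g \<in> F \<and> k = w (\<tau> g y)}" for y
  have w: "discrete_rv Y w" using wd by (simp add: admissible_def)
  have U: "finite (F \<times> w ` space Y)" using F fin by simp
  have sU: "s y \<subseteq> F \<times> w ` space Y" if "y \<in> space Y" for y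
    using tau_space[OF that] by (auto simp: s_def)
  have s: "discrete_rv Y s"
  proof (rule discrete_rv_finite_set[OF countable_finite[OF U]])
    fix y assume "y \<in> space Y"
    from sU[OF this] show "finite (s y) \<and> s y \<subseteq> F \<times> w ` space Y"
      using U finite_subset by blast
  next
    fix p assume p: "p \<in> F \<times> w ` space Y"
    have "{y \<in> space Y. p \<in> s y} = {y \<in> space Y. w (\<tau> (fst p) y) = snd p}"
      using p by (auto simp: s_def)
    then show "{y \<in> space Y. p \<in> s y} \<in> sets Y"
      using discrete_rv_fibre[OF discrete_rv_comp[OF w tau]] by simp
  qed
  let ?q = "\<lambda>y. (order_code F y, s y)"
  have q: "discrete_rv Y ?q" by (intro discrete_rv_Pair discrete_order_code F s)
  have "?q ` space Y \<subseteq> Pow (F \<times> F) \<times> Pow (F \<times> w ` space Y)"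
    using sU by (auto simp: order_code_def)
  then have finq: "finite (?q ` space Y)"
    by (rule finite_subset) (use F U in auto)
  have code: "w (\<tau> g y) = w (\<tau> g z)" if "g \<in> F" "?q y = ?q z" for g y z
  proof -
    have "(g, w (\<tau> g y)) \<in> s z" using that by (auto simp: s_def)
    then show ?thesis by (simp add: s_def)
  qed
  \<comment> \<open>Membership of \<open>g\<close> in the translate by \<open>- k\<close> means
    \<open>k + g \<in> F\<close>, so \<open>bad\<close> collects the \<open>g\<close> whose
    translated past leaves \<open>F\<close>.\<close>
  define bad where "bad = (\<Union>k\<in>?K. F - (\<lambda>h. - k + h) ` F)"
  have good: "visit_entropy ?q F g \<le> past_entropy w d" if g: "g \<in> F - bad" for g
  proof (rule visit_entropy_le[OF F q wd])
    fix y k assume "y \<in> space Y" "k \<in> d (w y)"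
    then have "g \<in> (\<lambda>h. - k + h) ` F" using g unfolding bad_def by blast
    then obtain h where "h \<in> F" "g = - k + h" by auto
    then show "k + g \<in> F" by simp
  next
    fix y z assume "?q y = ?q z"
    then show "w (\<tau> g y) = w (\<tau> g z)" using code g by (metis DiffD1)
  qed
  have "rel_part_entropy M (orbit_partition F) factor_algebra
     \<le> (\<integral>x. cond_info M (\<lambda>x. visits x \<inter> F) (\<lambda>x. ?q (\<phi> x)) x \<partial>M)"
    by (rule rel_part_entropy_le[OF F q finq])
  also have "\<dots> = (\<Sum>g\<in>F. visit_entropy ?q F g)"
    by (rule integral_cond_info_visits[OF F q]) (auto dest: order_code_eq)
  also have "\<dots> \<le> (\<Sum>g\<in>F. past_entropy w d + (if g \<in> bad then ln 2 else 0))"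
  proof (rule sum_mono)
    fix g assume "g \<in> F"
    then show "visit_entropy ?q F g \<le> past_entropy w d + (if g \<in> bad then ln 2 else 0)"
      using good[of g] visit_entropy_le_ln2[OF F q, of g] past_entropy_nonneg[OF wd] by (cases "g \<in> bad") auto
  qed
  also have "\<dots> = card F * past_entropy w d + card (F \<inter> bad) * ln 2"
    using F by (simp add: sum.distrib sum.If_cases)
  also have "card (F \<inter> bad) * ln 2 \<le>
      (\<Sum>k\<in>?K. real (card F) - card (F \<inter> (\<lambda>h. - k + h) ` F)) * ln 2"
  proof (rule mult_right_mono)
    have "F \<inter> bad = bad" by (auto simp: bad_def)
    then have "card (F \<inter> bad) \<le> (\<Sum>k\<in>?K. card (F - (\<lambda>h. - k + h) ` F))"
      unfolding bad_def using card_UN_le[OF K, of "\<lambda>k. F - (\<lambda>h. - k + h) ` F"] by (simp only:)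
    also have "real \<dots> = (\<Sum>k\<in>?K. real (card F) - card (F \<inter> (\<lambda>h. - k + h) ` F))"
      unfolding of_nat_sum
    proof (rule sum.cong[OF refl])
      fix k
      have "card (F \<inter> (\<lambda>h. - k + h) ` F) \<le> card F" using F by (intro card_mono) auto
      then show "real (card (F - (\<lambda>h. - k + h) ` F)) = real (card F) - card (F \<inter> (\<lambda>h. - k + h) ` F)"
        using F by (simp add: card_Diff_subset_Int of_nat_diff)
    qed
    finally show "real (card (F \<inter> bad)) \<le> (\<Sum>k\<in>?K. real (card F) - card (F \<inter> (\<lambda>h. - k + h) ` F))" by simp
  qed simp
  finally show ?thesis by simp
qed

text \<open>The lower bound holds for every nonempty \<open>F n\<close>. For the upper bound a
  truncated code has only finitely many possible past elements in total, so finitely many Folner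
  defects have to tend to 0.\<close>

lemma rel_part_entropy_limit:
  assumes F: "folner F"
  shows "(\<lambda>n. rel_part_entropy M (orbit_partition (F n)) factor_algebra / card (F n)) \<longlonglongrightarrow> present_entropy"
proof (rule tendstoI)
  let ?r = "\<lambda>g n. real (card (F n \<inter> (\<lambda>h. g + h) ` F n)) / card (F n)"
  fix \<epsilon> :: real assume eps: "0 < \<epsilon>"
  have fin: "finite (F n)" and lim: "?r g \<longlonglongrightarrow> 1" for n g
    using F by (auto simp: folner_def)
  \<comment> \<open>For an empty \<open>F n\<close> the ratio at the unit would be
    \<open>0 / 0 = 0\<close>; since it tends to 1, the sets are eventually nonempty.\<close>
  have "eventually (\<lambda>n. 0 < ?r 0 n) sequentially"
    using order_tendstoD(1)[OF lim[of 0], of 0] by simp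
  then have ne: "eventually (\<lambda>n. 0 < real (card (F n))) sequentially"
    by eventually_elim (auto simp: zero_less_divide_iff intro: Nat.gr0I)
  \<comment> \<open>Approximation costs \<open>\<epsilon> / 2\<close> and truncation
    \<open>\<epsilon> / 4\<close>, which leaves room for the Folner error.\<close>
  obtain w0 :: "'y \<Rightarrow> nat" and d0 where wd0: "admissible w0 d0" "past_entropy w0 d0 < present_entropy + \<epsilon> / 2"
    using present_entropy_approx[of "\<epsilon> / 2"] eps by auto
  obtain w :: "'y \<Rightarrow> nat" and d where wd: "admissible w d" "finite (w ` space Y)"
      "past_entropy w d \<le> past_entropy w0 d0 + \<epsilon> / 4"
    using truncate_code[OF wd0(1), of "\<epsilon> / 4"] eps by auto
  let ?K = "\<Union>y\<in>space Y. d (w y)"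
  have "(\<lambda>n. past_entropy w d + (\<Sum>k\<in>?K. 1 - ?r (- k) n) * ln 2) \<longlonglongrightarrow> past_entropy w d + (\<Sum>k\<in>?K. 1 - 1) * ln 2"
    by (intro tendsto_intros lim)
  moreover have "past_entropy w d + (\<Sum>k\<in>?K. 1 - 1) * ln 2 < present_entropy + \<epsilon>"
    using wd wd0 eps by simp
  ultimately have "eventually (\<lambda>n. past_entropy w d + (\<Sum>k\<in>?K. 1 - ?r (- k) n) * ln 2 < present_entropy + \<epsilon>) sequentially"
    by (rule order_tendstoD(2))
  then show "eventually (\<lambda>n. dist (rel_part_entropy M (orbit_partition (F n)) factor_algebra / card (F n))
      present_entropy < \<epsilon>) sequentially"
    using ne
  proof eventually_elim
    case (elim n)
    let ?c = "real (card (F n))"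
    let ?H = "rel_part_entropy M (orbit_partition (F n)) factor_algebra"
    have "present_entropy \<le> ?H / ?c"
      using rel_part_entropy_ge[OF fin, of n] elim by (simp add: pos_le_divide_eq mult.commute)
    moreover have "?H / ?c \<le> (?c * past_entropy w d +
       (\<Sum>k\<in>?K. ?c - card (F n \<inter> (\<lambda>h. - k + h) ` F n)) * ln 2) / ?c"
      using rel_part_entropy_upper[OF fin wd(1,2), of n] elim by (intro divide_right_mono) auto
    moreover have "\<dots> = past_entropy w d + (\<Sum>k\<in>?K. 1 - ?r (- k) n) * ln 2"
    proof -
      have "(\<Sum>k\<in>?K. 1 - ?r (- k) n) = (\<Sum>k\<in>?K. ?c - card (F n \<inter> (\<lambda>h. - k + h) ` F n)) / ?c"
        unfolding sum_divide_distrib using elim by (intro sum.cong) (auto simp: diff_divide_distrib)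
      moreover have "?c \<noteq> 0" using elim by simp
      ultimately show ?thesis
        by (simp only: add_divide_distrib nonzero_mult_div_cancel_left times_divide_eq_left not_False_eq_True)
    qed
    ultimately show ?case using elim(1) unfolding dist_real_def abs_less_iff by linarith
  qed
qed

text \<open>The existence of a Folner sequence makes the number described in
  \<open>rel_entropy\<close> unique.\<close>

lemma rel_entropy_eq:
  assumes "\<exists>F :: nat \<Rightarrow> 'g set. folner F"
  shows "rel_entropy M T {A, space M - A} factor_algebra = present_entropy"
  unfolding rel_entropy_def
proof (rule the_equality)
  show "\<forall>F :: nat \<Rightarrow> 'g set. folner F \<longrightarrow>
    (\<lambda>n. rel_part_entropy M (orbit_partition (F n)) factor_algebra / card (F n)) \<longlonglongrightarrow> present_entropy"
    by (intro allI impI rel_part_entropy_limit)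
  fix h
  assume h: "\<forall>F :: nat \<Rightarrow> 'g set. folner F \<longrightarrow>
    (\<lambda>n. rel_part_entropy M (orbit_partition (F n)) factor_algebra / card (F n)) \<longlonglongrightarrow> h"
  obtain F :: "nat \<Rightarrow> 'g set" where F: "folner F" using assms by blast
  show "h = present_entropy"
    by (rule LIMSEQ_unique[OF h[rule_format, OF F] rel_part_entropy_limit[OF F]])
qed

end

text \<open>Phrases the present through \<open>A\<close> alone, an event common to both actions, so
  that their past entropies can be compared.\<close>

lemma (in ordered_action) past_entropy_eq:
  assumes wd: "admissible w d"
  shows "past_entropy w d = (\<integral>x. cond_info M (\<lambda>x. x \<in> A) (past_code w d) x \<partial>M)"
  unfolding past_entropy_def
proof (rule integral_cond_info_cong[OF discrete_visit discrete_rv_mem[OF A] discrete_past_code[OF wd]])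
  show "AE x in M. (0 \<in> visits x) = (x \<in> A)"
    using T_0 by eventually_elim (simp add: visits_def)
qed

lemma (in ordered_action) present_entropy_ge:
  assumes "\<And>(w :: 'y \<Rightarrow> nat) d. admissible w d \<Longrightarrow> c \<le> past_entropy w d"
  shows "c \<le> present_entropy"
proof (rule field_le_epsilon)
  fix e :: real assume "0 < e"
  then obtain w :: "'y \<Rightarrow> nat" and d where "admissible w d" "past_entropy w d < present_entropy + e"
    by (rule present_entropy_approx)
  then show "c \<le> present_entropy + e" using assms[of w d] by linarith
qed


section \<open>Orders of type Z\<close>

definition covers :: "('g \<times> 'g \<Rightarrow> bool) \<Rightarrow> 'g \<Rightarrow> 'g \<Rightarrow> bool" where
  "covers r a b \<longleftrightarrow> r (a, b) \<and> \<not> (\<exists>c. r (a, c) \<and> r (c, b))"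

definition next_elem :: "('g \<times> 'g \<Rightarrow> bool) \<Rightarrow> 'g \<Rightarrow> 'g" where
  "next_elem r a = (THE b. covers r a b)"

definition prev_elem :: "('g \<times> 'g \<Rightarrow> bool) \<Rightarrow> 'g \<Rightarrow> 'g" where
  "prev_elem r b = (THE a. covers r a b)"

text \<open>For an order of type Z this is the order isomorphism from the integers onto the group
  that sends 0 to the unit.\<close>

definition nth_elem :: "('g::group_add \<times> 'g \<Rightarrow> bool) \<Rightarrow> int \<Rightarrow> 'g" where
  "nth_elem r k = (if 0 \<le> k then (next_elem r ^^ nat k) 0 else (prev_elem r ^^ nat (- k)) 0)"

lemma Z_order_irrefl: "r \<in> Z_orders \<Longrightarrow> \<not> r (a, a)"
  by (auto simp: Z_orders_def strict_linear_order_on_def irrefl_def)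

lemma Z_order_trans: "r \<in> Z_orders \<Longrightarrow> r (a, b) \<Longrightarrow> r (b, c) \<Longrightarrow> r (a, c)"
  unfolding Z_orders_def strict_linear_order_on_def trans_def by blast

lemma Z_order_total: "r \<in> Z_orders \<Longrightarrow> a \<noteq> b \<Longrightarrow> r (a, b) \<or> r (b, a)"
  by (auto simp: Z_orders_def strict_linear_order_on_def total_on_def)

lemma Z_order_finite: "r \<in> Z_orders \<Longrightarrow> finite {c. r (a, c) \<and> r (c, b)}"
proof (cases "r (a, b)")
  case False
  assume r: "r \<in> Z_orders"
  have "{c. r (a, c) \<and> r (c, b)} = {}" using False Z_order_trans[OF r, of a _ b] by blast
  then show ?thesis by (simp only: finite.emptyI)
qed (auto simp: Z_orders_def order_interval_def)

text \<open>Lets the facts on predecessors be read off from those on successors.\<close>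

lemma Z_order_converse:
  assumes r: "r \<in> Z_orders"
  shows "(\<lambda>(a, b). r (b, a)) \<in> Z_orders"
proof -
  have "finite (order_interval (\<lambda>(a, b). r (b, a)) a b)" for a b
    using Z_order_finite[OF r, of b a] by (simp add: order_interval_def conj_commute)
  moreover have "strict_linear_order_on UNIV {p. case p of (a, b) \<Rightarrow> r (b, a)}"
    unfolding strict_linear_order_on_def
  proof (intro conjI)
    show "trans {p. case p of (a, b) \<Rightarrow> r (b, a)}"
      by (rule transI) (auto intro: Z_order_trans[OF r])
    show "irrefl {p. case p of (a, b) \<Rightarrow> r (b, a)}"
      by (simp add: irrefl_def Z_order_irrefl[OF r])
    show "total {p. case p of (a, b) \<Rightarrow> r (b, a)}"
      using Z_order_total[OF r] by (simp add: total_on_def)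
  qed
  moreover have "\<forall>a. \<exists>b. r (b, a)" "\<forall>a. \<exists>b. r (a, b)"
    using r by (simp_all add: Z_orders_def)
  ultimately show ?thesis unfolding Z_orders_def mem_Collect_eq by simp
qed

lemma covers_unique: "r \<in> Z_orders \<Longrightarrow> covers r a b \<Longrightarrow> covers r a c \<Longrightarrow> b = c"
  unfolding covers_def using Z_order_total by metis

text \<open>Descent on the finite number of elements strictly between \<open>a\<close> and
  \<open>b\<close>, starting from any \<open>b\<close> above \<open>a\<close>.\<close>

lemma ex_covers:
  assumes r: "r \<in> Z_orders"
  shows "\<exists>b. covers r a b"
proof -
  have "\<forall>a. \<exists>b. r (a, b)" using r by (simp add: Z_orders_def)
  then obtain b where b: "r (a, b)" by blast
  show ?thesis using b
  proof (induction "card {c. r (a, c) \<and> r (c, b)}" arbitrary: b rule: less_induct)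
    case less
    show ?case
    proof (cases "covers r a b")
      case False
      then obtain c where c: "r (a, c)" "r (c, b)" using less.prems by (auto simp: covers_def)
      have "{d. r (a, d) \<and> r (d, c)} \<subset> {d. r (a, d) \<and> r (d, b)}"
        using c Z_order_trans[OF r] Z_order_irrefl[OF r] by blast
      then have "card {d. r (a, d) \<and> r (d, c)} < card {d. r (a, d) \<and> r (d, b)}"
        by (rule psubset_card_mono[OF Z_order_finite[OF r]])
      from less.hyps[OF this c(1)] show ?thesis .
    qed blast
  qed
qed

lemma covers_next_elem: "r \<in> Z_orders \<Longrightarrow> covers r a (next_elem r a)"
  unfolding next_elem_def using ex_covers covers_unique by (metis (mono_tags, lifting) theI)

lemma covers_next_elem_iff: "r \<in> Z_orders \<Longrightarrow> covers r a b \<longleftrightarrow> next_elem r a = b"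
  using covers_next_elem covers_unique by metis

lemma covers_converse: "covers (\<lambda>(a, b). r (b, a)) b a \<longleftrightarrow> covers r a b"
  by (auto simp: covers_def)

lemma prev_elem_converse: "prev_elem r = next_elem (\<lambda>(a, b). r (b, a))"
  unfolding prev_elem_def next_elem_def covers_converse ..

lemma covers_prev_elem_iff: "r \<in> Z_orders \<Longrightarrow> covers r a b \<longleftrightarrow> prev_elem r b = a"
  using covers_next_elem_iff[OF Z_order_converse] by (simp add: prev_elem_converse covers_converse)

lemma nth_elem_0 [simp]: "nth_elem r 0 = 0"
  by (simp add: nth_elem_def)

lemma nth_elem_1: "nth_elem r 1 = succ_unit r"
  by (simp add: nth_elem_def next_elem_def succ_unit_def covers_def)

lemma nth_elem_covers:
  assumes r: "r \<in> Z_orders"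
  shows "covers r (nth_elem r k) (nth_elem r (k + 1))"
proof (cases "0 \<le> k")
  case True
  then have "nth_elem r (k + 1) = next_elem r (nth_elem r k)"
    by (simp add: nth_elem_def nat_add_distrib)
  then show ?thesis using covers_next_elem[OF r] by simp
next
  case False
  \<comment> \<open>With \<open>k + 1 = - n\<close>, both positions lie in the branch of
    \<open>nth_elem\<close> that iterates \<open>prev_elem\<close> (at \<open>n = 0\<close> the
    branches agree), and \<open>k\<close> is one step further.\<close>
  define n where "n = nat (- (k + 1))"
  have k: "k = - int (Suc n)" "k + 1 = - int n" using False by (auto simp: n_def)
  have "nth_elem r k = prev_elem r (nth_elem r (k + 1))"
    unfolding k by (cases n) (auto simp: nth_elem_def nat_add_distrib)
  then show ?thesis using covers_prev_elem_iff[OF r] by simp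
qed

lemma nth_elem_less:
  assumes r: "r \<in> Z_orders" and "i < j"
  shows "r (nth_elem r i, nth_elem r j)"
  using \<open>i < j\<close>
proof (induction j rule: int_gr_induct)
  case base
  then show ?case using nth_elem_covers[OF r, of i] by (simp add: covers_def)
next
  case (step j)
  then show ?case using nth_elem_covers[OF r, of j] Z_order_trans[OF r] by (auto simp: covers_def)
qed

lemma nth_elem_inj: "r \<in> Z_orders \<Longrightarrow> nth_elem r i = nth_elem r j \<Longrightarrow> i = j"
  using nth_elem_less Z_order_irrefl by (metis linorder_neqE)

text \<open>Induction on the number of elements between \<open>h\<close> and the unit, passing from
  \<open>h\<close> to its successor.\<close>

lemma nth_elem_past:
  assumes r: "r \<in> Z_orders" and h: "r (h, 0)"
  shows "\<exists>i<0. nth_elem r i = h"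
  using h
proof (induction "card {c. r (h, c) \<and> r (c, 0)}" arbitrary: h rule: less_induct)
  case less
  let ?n = "next_elem r h"
  have cov: "covers r h ?n" by (rule covers_next_elem[OF r])
  then have hn: "r (h, ?n)" by (simp add: covers_def)
  have "\<exists>i\<le>0. nth_elem r i = ?n"
  proof (cases "?n = 0")
    case False
    have "\<not> r (0, ?n)" using less.prems cov by (auto simp: covers_def)
    then have n0: "r (?n, 0)" using Z_order_total[OF r False] by blast
    have "{c. r (?n, c) \<and> r (c, 0)} \<subset> {c. r (h, c) \<and> r (c, 0)}"
      using hn n0 Z_order_trans[OF r] Z_order_irrefl[OF r] by blast
    then have "card {c. r (?n, c) \<and> r (c, 0)} < card {c. r (h, c) \<and> r (c, 0)}"
      by (rule psubset_card_mono[OF Z_order_finite[OF r]])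
    from less.hyps[OF this n0] show ?thesis by (metis less_imp_le)
  qed (auto intro!: exI[of _ 0])
  then obtain i where i: "i \<le> 0" "nth_elem r i = ?n" by auto
  have "nth_elem r (i - 1) = h"
    using nth_elem_covers[OF r, of "i - 1"] cov i(2) covers_prev_elem_iff[OF r] by auto
  then show ?case using i(1) by (intro exI[of _ "i - 1"]) auto
qed

section \<open>Translating the enumeration, and Folner intervals of integers\<close>

lemma order_act_add: "order_act (g + h) r = order_act g (order_act h r)"
  by (auto simp: order_act_def add.assoc)

lemma order_act_covers: "covers (order_act g r) a b \<longleftrightarrow> covers r (a + g) (b + g)"
  unfolding covers_def order_act_def by (simp, metis diff_add_cancel)

text \<open>Right translation by the element at position \<open>j\<close> maps covering pairs of the
  translated order to covering pairs of \<open>r\<close>. Both sides therefore walk along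
  \<open>r\<close> from the same starting point. This is the cocycle identity behind
  \<open>shift_add\<close>.\<close>

lemma nth_elem_order_act:
  assumes r: "r \<in> Z_orders" and r': "order_act (nth_elem r j) r \<in> Z_orders"
  shows "nth_elem (order_act (nth_elem r j) r) k + nth_elem r j = nth_elem r (k + j)"
proof -
  let ?g = "nth_elem r j"
  have cov: "covers r (nth_elem (order_act ?g r) k + ?g) (nth_elem (order_act ?g r) (k + 1) + ?g)" for k
    using nth_elem_covers[OF r', of k] by (simp add: order_act_covers)
  show ?thesis
  proof (induction k rule: int_induct[where k = 0])
    case (step1 i)
    have "next_elem r (nth_elem r (i + j)) = nth_elem (order_act ?g r) (i + 1) + ?g"
      using cov[of i] step1 covers_next_elem_iff[OF r] by simp
    moreover have "next_elem r (nth_elem r (i + j)) = nth_elem r (i + j + 1)"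
      using nth_elem_covers[OF r] covers_next_elem_iff[OF r] by simp
    ultimately show ?case by (simp add: ac_simps)
  next
    case (step2 i)
    have "prev_elem r (nth_elem r (i + j)) = nth_elem (order_act ?g r) (i - 1) + ?g"
      using cov[of "i - 1"] step2 covers_prev_elem_iff[OF r] by simp
    moreover have "prev_elem r (nth_elem r (i + j)) = nth_elem r (i + j - 1)"
      using nth_elem_covers[OF r, of "i + j - 1"] covers_prev_elem_iff[OF r] by simp
    ultimately show ?case by (simp add: algebra_simps)
  qed simp
qed

text \<open>Once \<open>n\<close> exceeds the absolute value of \<open>g\<close>, the interval and
  its translate share all but that many points.\<close>

lemma folner_int: "folner (\<lambda>n. {0..<int n})"
  unfolding folner_def
proof (intro conjI allI)
  fix g :: int
  have card: "real (card ({0..<int n} \<inter> (\<lambda>h. g + h) ` {0..<int n})) / real (card {0..<int n}) =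
      1 - real_of_int \<bar>g\<bar> / real n" if n: "nat \<bar>g\<bar> < n" for n
  proof -
    have "{0..<int n} \<inter> (\<lambda>h. g + h) ` {0..<int n} = {max 0 g..<min (int n) (g + int n)}"
      by (auto simp: image_iff Bex_def intro!: exI[of _ "_ - g"])
    then have "int (card ({0..<int n} \<inter> (\<lambda>h. g + h) ` {0..<int n})) = int n - \<bar>g\<bar>"
      using n by (auto simp: max_def min_def)
    then have "real (card ({0..<int n} \<inter> (\<lambda>h. g + h) ` {0..<int n})) = real n - real_of_int \<bar>g\<bar>"
      by (metis of_int_diff of_int_of_nat_eq)
    then show ?thesis using n by (simp add: diff_divide_distrib)
  qed
  have "(\<lambda>n. 1 - real_of_int \<bar>g\<bar> / real n) \<longlonglongrightarrow> 1 - 0"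
    by (intro tendsto_intros lim_const_over_n)
  moreover have "eventually (\<lambda>n. 1 - real_of_int \<bar>g\<bar> / real n =
      real (card ({0..<int n} \<inter> (\<lambda>h. g + h) ` {0..<int n})) / real (card {0..<int n})) sequentially"
    using eventually_gt_at_top[of "nat \<bar>g\<bar>"] by eventually_elim (simp only: card)
  ultimately show "(\<lambda>n. real (card ({0..<int n} \<inter> (\<lambda>h. g + h) ` {0..<int n})) / real (card {0..<int n})) \<longlonglongrightarrow> 1"
    by (simp add: filterlim_cong[OF refl refl])
qed simp


section \<open>The successor map of a multiorder\<close>

locale multiordered_system = prob_space M for M :: "'x measure" +
  fixes act :: "'g::group_add \<Rightarrow> 'x \<Rightarrow> 'x" and \<nu> :: "('g \<times> 'g \<Rightarrow> bool) measure"
    and \<phi> :: "'x \<Rightarrow> 'g \<times> 'g \<Rightarrow> bool"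
  assumes countable_group: "countable (UNIV :: 'g set)"
    and action: "pmp_action M act" and order: "multiorder \<nu>" and factor: "factor_map M act \<nu> order_act \<phi>"
begin

lemma act: "act g \<in> measurable M M" "distr M M (act g) = M"
  using action by (auto simp: pmp_action_def)

lemma act_add: "x \<in> space M \<Longrightarrow> act (g + h) x = act g (act h x)"
  using action by (auto simp: pmp_action_def)

lemma act_0: "x \<in> space M \<Longrightarrow> act 0 x = x"
  using action by (auto simp: pmp_action_def)

lemma act_space: "x \<in> space M \<Longrightarrow> act g x \<in> space M"
  using measurable_space[OF act(1)] .

lemma space_nu: "space \<nu> = Z_orders"
  using order by (simp add: multiorder_def)

lemma sets_nu: "sets \<nu> = sets (restrict_space borel Z_orders)"
  using order by (simp add: multiorder_def)

lemma order_act_measurable: "order_act g \<in> measurable \<nu> \<nu>"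
  using order by (auto simp: multiorder_def pmp_action_def)

lemma order_act_Z:
  fixes r :: "'g \<times> 'g \<Rightarrow> bool"
  shows "r \<in> Z_orders \<Longrightarrow> order_act g r \<in> Z_orders"
  using measurable_space[OF order_act_measurable] space_nu by auto

lemma phi_measurable: "\<phi> \<in> measurable M \<nu>"
  using factor by (auto simp: factor_map_def)

lemma phi_Z: "x \<in> space M \<Longrightarrow> \<phi> x \<in> Z_orders"
  using measurable_space[OF phi_measurable] space_nu by auto

text \<open>Equivariance for all group elements at once; the set of such points is preserved by the
  action, so identities can be iterated along an orbit.\<close>

definition equivariant_at :: "'x \<Rightarrow> bool" where
  "equivariant_at x \<longleftrightarrow> x \<in> space M \<and> (\<forall>g. \<phi> (act g x) = order_act g (\<phi> x))"

lemma AE_equivariant: "AE x in M. equivariant_at x"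
proof -
  have "AE x in M. \<forall>g. \<phi> (act g x) = order_act g (\<phi> x)"
    unfolding AE_ball_countable[OF countable_group, unfolded ball_UNIV]
    using factor by (auto simp: factor_map_def)
  then show ?thesis unfolding equivariant_at_def using AE_space by eventually_elim auto
qed

lemma equivariant_at_act: "equivariant_at x \<Longrightarrow> equivariant_at (act g x)"
  unfolding equivariant_at_def by (simp add: act_space act_add[symmetric] order_act_add[symmetric])

section \<open>Measurability of the enumeration\<close>

lemma coordinate_sets: "{r \<in> space \<nu>. r p} \<in> sets \<nu>"
proof -
  \<comment> \<open>Exhibits \<open>{True}\<close> as an open ray, so that a coordinate condition is
    open in the product topology.\<close>
  have "{False<..} = {True}" by auto
  then have "open {True}" using open_greaterThan[of False] by simp
  then have "open ((\<lambda>r :: 'g \<times> 'g \<Rightarrow> bool. r p) -` {True})"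
    by (rule open_vimage[OF _ continuous_on_product_coordinates])
  then have "(\<lambda>r :: 'g \<times> 'g \<Rightarrow> bool. r p) -` {True} \<in> sets borel" by simp
  moreover have "{r \<in> space \<nu>. r p} = Z_orders \<inter> (\<lambda>r. r p) -` {True}"
    by (auto simp: space_nu)
  ultimately show ?thesis unfolding sets_nu sets_restrict_space by auto
qed

lemma covers_sets: "{r \<in> space \<nu>. covers r a b} \<in> sets \<nu>"
proof -
  have "{r \<in> space \<nu>. \<exists>c\<in>UNIV. r (a, c) \<and> r (c, b)} \<in> sets \<nu>"
    by (intro sets.sets_Collect_countable_Ex'[OF _ countable_group] sets.sets_Collect_conj coordinate_sets)
  then have "{r \<in> space \<nu>. r (a, b) \<and> \<not> (\<exists>c\<in>UNIV. r (a, c) \<and> r (c, b))} \<in> sets \<nu>"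
    by (intro sets.sets_Collect_conj sets.sets_Collect_neg coordinate_sets)
  then show ?thesis by (simp add: covers_def)
qed

text \<open>Induction away from position 0 in both directions; each step is a countable union over
  the element at the previous position.\<close>

lemma nth_elem_sets: "{r \<in> space \<nu>. nth_elem r k = g} \<in> sets \<nu>"
proof (induction k arbitrary: g rule: int_induct[where k = 0])
  case base
  then show ?case by simp
next
  case (step1 i)
  have "covers r (nth_elem r i) g \<longleftrightarrow> nth_elem r (i + 1) = g" if "r \<in> Z_orders" for r :: "'g \<times> 'g \<Rightarrow> bool"
    using nth_elem_covers[OF that, of i] covers_next_elem_iff[OF that] by simp
  then have "{r \<in> space \<nu>. nth_elem r (i + 1) = g} = {r \<in> space \<nu>. \<exists>a\<in>UNIV. nth_elem r i = a \<and> covers r a g}"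
    by (auto simp: space_nu)
  also have "\<dots> \<in> sets \<nu>"
    by (intro sets.sets_Collect_countable_Ex'[OF _ countable_group] sets.sets_Collect_conj step1 covers_sets)
  finally show ?case .
next
  case (step2 i)
  have "covers r g (nth_elem r i) \<longleftrightarrow> nth_elem r (i - 1) = g" if "r \<in> Z_orders" for r :: "'g \<times> 'g \<Rightarrow> bool"
    using nth_elem_covers[OF that, of "i - 1"] covers_prev_elem_iff[OF that] by simp
  then have "{r \<in> space \<nu>. nth_elem r (i - 1) = g} = {r \<in> space \<nu>. \<exists>a\<in>UNIV. nth_elem r i = a \<and> covers r g a}"
    by (auto simp: space_nu)
  also have "\<dots> \<in> sets \<nu>"
    by (intro sets.sets_Collect_countable_Ex'[OF _ countable_group] sets.sets_Collect_conj step2 covers_sets)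
  finally show ?case .
qed

lemma nth_elem_measurable: "(\<lambda>r. nth_elem r k) \<in> measurable \<nu> (count_space UNIV)"
proof -
  have "discrete_rv \<nu> (\<lambda>r. nth_elem r k)"
    using nth_elem_sets countable_subset[OF subset_UNIV countable_group]
    unfolding discrete_rv_def by auto
  then show ?thesis by (rule discrete_rv_measurable) auto
qed

section \<open>The powers of the successor map and their invariance\<close>

text \<open>Almost everywhere this is the \<open>k\<close>-th power of the successor map, for
  positive and negative \<open>k\<close> alike, written as a single group element that depends on
  \<open>x\<close>.\<close>

definition shift :: "int \<Rightarrow> 'x \<Rightarrow> 'x" where
  "shift k x = act (nth_elem (\<phi> x) k) x"

definition order_shift :: "int \<Rightarrow> ('g \<times> 'g \<Rightarrow> bool) \<Rightarrow> ('g \<times> 'g \<Rightarrow> bool)" where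
  "order_shift k r = order_act (nth_elem r k) r"

lemma order_shift_measurable: "order_shift k \<in> measurable \<nu> \<nu>"
  unfolding order_shift_def[abs_def]
  by (rule measurable_compose_countable'[OF order_act_measurable nth_elem_measurable countable_group])

lemma shift_measurable: "shift k \<in> measurable M M"
  unfolding shift_def[abs_def]
  by (rule measurable_compose_countable'[OF act(1)
        measurable_compose[OF phi_measurable nth_elem_measurable] countable_group])

lemma nth_elem_act:
  assumes "equivariant_at x"
  shows "nth_elem (\<phi> (act (nth_elem (\<phi> x) j) x)) k + nth_elem (\<phi> x) j = nth_elem (\<phi> x) (k + j)"
proof -
  have "\<phi> x \<in> Z_orders" and e: "\<phi> (act g x) = order_act g (\<phi> x)" for g
    using assms phi_Z by (auto simp: equivariant_at_def)
  then show ?thesis unfolding e by (intro nth_elem_order_act order_act_Z)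
qed

lemma shift_add:
  assumes "equivariant_at x"
  shows "shift (i + j) x = shift i (shift j x)"
  using assms unfolding shift_def nth_elem_act[OF assms, symmetric]
  by (intro act_add) (simp add: equivariant_at_def)

lemma shift_0: "x \<in> space M \<Longrightarrow> shift 0 x = x"
  by (simp add: shift_def act_0)

text \<open>Seen from \<open>act g x\<close>, the point \<open>x\<close> is reached by
  \<open>- g\<close>, so \<open>k\<close> steps forward by \<open>g\<close> are undone by
  \<open>k\<close> steps back by \<open>- g\<close>.\<close>

lemma nth_elem_inverse:
  assumes "equivariant_at x"
  shows "nth_elem (\<phi> x) k = g \<longleftrightarrow> nth_elem (\<phi> (act g x)) (- k) = - g"
proof
  assume "nth_elem (\<phi> x) k = g"
  with nth_elem_act[OF assms, of k "- k"]
  show "nth_elem (\<phi> (act g x)) (- k) = - g" by (simp add: eq_neg_iff_add_eq_0)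
next
  assume a: "nth_elem (\<phi> (act g x)) (- k) = - g"
  have "act (- g) (act g x) = x"
    using assms by (simp add: equivariant_at_def act_add[symmetric] act_0)
  with a nth_elem_act[OF equivariant_at_act[OF assms], of g "- k" k]
  show "nth_elem (\<phi> x) k = g" by simp
qed

text \<open>Mass transport: cutting by the value \<open>g\<close> of \<open>nth_elem\<close> and moving the piece by
  \<open>act g\<close> rearranges it into the piece where the inverse step equals \<open>- g\<close>.\<close>

lemma shift_preserves: "distr M M (shift k) = M"
proof (rule measure_eqI)
  fix B assume "B \<in> sets (distr M M (shift k))"
  then have B: "B \<in> sets M" by simp
  let ?P = "\<lambda>g. {x \<in> space M. nth_elem (\<phi> x) k = g \<and> act g x \<in> B}"
  let ?Q = "\<lambda>g. {y \<in> space M. nth_elem (\<phi> y) (- k) = - g \<and> y \<in> B}"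
  have nth: "{x \<in> space M. nth_elem (\<phi> x) j = g} \<in> sets M" for j g
    using measurable_sets[OF measurable_compose[OF phi_measurable nth_elem_measurable], of "{g}" j]
    by (simp add: vimage_def Int_def conj_commute)
  have "{x \<in> space M. act g x \<in> B} \<in> sets M" for g
    using measurable_sets[OF act(1) B, of g] by (simp add: vimage_def Int_def conj_commute)
  then have P: "?P g \<in> sets M" for g
    by (intro sets.sets_Collect_conj nth)
  have "{y \<in> space M. y \<in> B} = B" using sets.sets_into_space[OF B] by auto
  then have Q: "?Q g \<in> sets M" for g
    using B by (intro sets.sets_Collect_conj nth) simp
  have PQ: "emeasure M (?P g) = emeasure M (?Q g)" for g
  proof -
    have "emeasure M (?Q g) = emeasure (distr M M (act g)) (?Q g)" using act(2) by simp
    also have "\<dots> = emeasure M (act g -` ?Q g \<inter> space M)"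
      by (rule emeasure_distr[OF act(1) Q])
    also have "\<dots> = emeasure M (?P g)"
    proof (rule emeasure_eq_AE)
      show "AE x in M. x \<in> act g -` ?Q g \<inter> space M \<longleftrightarrow> x \<in> ?P g"
        using AE_equivariant
      proof eventually_elim
        case (elim x)
        then show ?case using nth_elem_inverse[OF elim, of k g] act_space
          by (auto simp: equivariant_at_def)
      qed
    qed (use P measurable_sets[OF act(1) Q] in auto)
    finally show ?thesis by simp
  qed
  have "shift k -` B \<inter> space M = (\<Union>g. ?P g)" by (auto simp: shift_def)
  then have "emeasure (distr M M (shift k)) B = emeasure M (\<Union>g. ?P g)"
    using emeasure_distr[OF shift_measurable B] by simp
  also have "\<dots> = (\<integral>\<^sup>+g. emeasure M (?P g) \<partial>count_space UNIV)"
    using P countable_group by (intro emeasure_UN_countable) (auto simp: disjoint_family_on_def)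
  also have "\<dots> = (\<integral>\<^sup>+g. emeasure M (?Q g) \<partial>count_space UNIV)" by (simp only: PQ)
  also have "\<dots> = emeasure M (\<Union>g. ?Q g)"
    using Q countable_group by (intro emeasure_UN_countable[symmetric]) (auto simp: disjoint_family_on_def)
  \<comment> \<open>A point \<open>y\<close> lies in the piece whose \<open>g\<close> is minus the
    element at position \<open>- k\<close> of its order.\<close>
  also have "(\<Union>g. ?Q g) = B"
    using sets.sets_into_space[OF B] by (auto intro!: exI[of _ "- nth_elem _ _"])
  finally show "emeasure (distr M M (shift k)) B = emeasure M B" .
qed simp

lemma AE_shift:
  assumes "AE x in M. P x"
  shows "AE x in M. P (shift k x)"
proof (rule AE_distrD[OF shift_measurable])
  show "AE x in distr M M (shift k). P x" using assms by (simp only: shift_preserves)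
qed

section \<open>The almost everywhere inverse and the integer action\<close>

abbreviation "S \<equiv> successor_map act \<phi>"

abbreviation "R \<equiv> ae_inverse M S"

lemma successor_map_eq: "S = shift 1"
  by (simp add: fun_eq_iff successor_map_def shift_def nth_elem_1)

text \<open>The map \<open>shift (- 1)\<close> witnesses that the choice in
  \<open>ae_inverse\<close> is from a nonempty set.\<close>

lemma ae_inverse:
  "R \<in> measurable M M" "AE x in M. R (S x) = x" "AE x in M. S (R x) = x"
proof -
  have "AE x in M. shift (- 1) (S x) = x" "AE x in M. S (shift (- 1) x) = x"
    unfolding successor_map_eq using AE_space AE_equivariant
    by (eventually_elim, simp add: shift_add[symmetric] shift_0)+
  then have "\<exists>R. R \<in> measurable M M \<and> (AE x in M. R (S x) = x) \<and> (AE x in M. S (R x) = x)"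
    using shift_measurable by blast
  from someI_ex[OF this]
  show "R \<in> measurable M M" "AE x in M. R (S x) = x" "AE x in M. S (R x) = x"
    unfolding ae_inverse_def by blast+
qed

text \<open>Evaluating \<open>R (S y) = y\<close> at \<open>y = shift (- 1) x\<close>, which is
  permitted almost everywhere because \<open>shift (- 1)\<close> preserves the measure.\<close>

lemma AE_ae_inverse_eq: "AE x in M. R x = shift (- 1) x"
  using AE_shift[OF ae_inverse(2), of "- 1"] AE_equivariant
proof eventually_elim
  case (elim x)
  have "S (shift (- 1) x) = x"
    using shift_add[OF elim(2), of 1 "- 1"] elim(2)
    by (simp add: successor_map_eq shift_0 equivariant_at_def)
  then show ?case using elim(1) by simp
qed

text \<open>At each further step the identity for \<open>f\<close> is used at an already shifted
  point; \<open>AE_shift\<close> moves the exceptional null set along.\<close>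

lemma AE_funpow_eq_shift:
  assumes f: "AE x in M. f x = shift k x"
  shows "AE x in M. (f ^^ n) x = shift (int n * k) x"
proof (induction n)
  case 0
  then show ?case using AE_space by (auto simp: shift_0 elim!: eventually_mono)
next
  case (Suc n)
  then show ?case using AE_shift[OF f, of "int n * k"] AE_equivariant
  proof eventually_elim
    case (elim x)
    then show ?case using shift_add[OF elim(3), of k "int n * k"] by (simp add: algebra_simps)
  qed
qed

lemma AE_Z_action: "AE x in M. Z_action M S k x = shift k x"
proof (cases "0 \<le> k")
  case True
  then show ?thesis using AE_funpow_eq_shift[of S 1 "nat k"]
    by (simp add: Z_action_def successor_map_eq)
next
  case False
  then show ?thesis using AE_funpow_eq_shift[OF AE_ae_inverse_eq, of "nat (- k)"]
    by (simp add: Z_action_def)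
qed

lemma Z_action_measurable: "Z_action M S k \<in> measurable M M"
proof -
  have "f ^^ n \<in> measurable M M" if "f \<in> measurable M M" for f and n :: nat
    using that by (induction n) (auto intro: measurable_comp)
  then show ?thesis
    using ae_inverse(1) shift_measurable by (simp add: Z_action_def successor_map_eq)
qed

lemma Z_action_preserves: "distr M M (Z_action M S k) = M"
  using distr_cong_AE[OF refl refl AE_Z_action Z_action_measurable shift_measurable]
  by (simp add: shift_preserves)

section \<open>The two ordered actions and the comparison of their entropies\<close>

lemma group_ordered_action:
  assumes "A \<in> sets M"
  shows "ordered_action M act \<nu> \<phi> order_act (\<lambda>r. r) A"
proof (intro ordered_action.intro ordered_action_axioms.intro)
  show "AE x in M. act (g + h) x = act g (act h x)" for g h by (rule AE_I2) (rule act_add)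
  show "AE x in M. act 0 x = x" by (rule AE_I2) (rule act_0)
  show "AE x in M. \<phi> (act g x) = order_act g (\<phi> x)" for g
    using factor by (auto simp: factor_map_def)
  show "r \<in> space \<nu> \<Longrightarrow> strict_linear_order_on UNIV {p. r p}" for r
    by (simp add: space_nu Z_orders_def)
  show "order_act g r (a, b) = r (a + g, b + g)" for g r a b by (simp add: order_act_def)
qed (use assms countable_group act phi_measurable order_act_measurable coordinate_sets prob_space_axioms in auto)

text \<open>The action laws hold almost everywhere because \<open>Z_action\<close> agrees there with
  \<open>shift\<close>; the compatibility of order and action is the translation invariance of
  \<open><\<close>.\<close>

lemma integer_ordered_action:
  assumes "A \<in> sets M"
  shows "ordered_action M (Z_action M S) \<nu> \<phi> order_shift (\<lambda>_ (i, j). i < j) A"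
proof (intro ordered_action.intro ordered_action_axioms.intro)
  show "AE x in M. Z_action M S (i + j) x = Z_action M S i (Z_action M S j x)" for i j
    using AE_Z_action[of "i + j"] AE_Z_action[of j] AE_shift[OF AE_Z_action[of i], of j] AE_equivariant
    by eventually_elim (simp add: shift_add)
  show "AE x in M. Z_action M S 0 x = x" by (simp add: Z_action_def)
  show "AE x in M. \<phi> (Z_action M S k x) = order_shift k (\<phi> x)" for k
    using AE_Z_action[of k] AE_equivariant
    by eventually_elim (simp add: shift_def order_shift_def equivariant_at_def)
  show "strict_linear_order_on UNIV {p. case p of (i, j) \<Rightarrow> i < (j :: int)}"
    by (auto simp: strict_linear_order_on_def trans_def irrefl_def total_on_def)
  show "{y \<in> space \<nu>. case p of (i, j) \<Rightarrow> i < (j :: int)} \<in> sets \<nu>" for p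
    by (cases "case p of (i, j) \<Rightarrow> i < j") auto
qed (use assms Z_action_measurable Z_action_preserves phi_measurable order_shift_measurable
      prob_space_axioms in auto)

text \<open>A finite set of past group elements and the finite set of their negative positions in the
  order carry the same information once the correspondence between them is recorded in the code.\<close>

lemma present_entropy_eq:
  assumes A: "A \<in> sets M"
  shows "ordered_action.present_entropy M act \<nu> \<phi> (\<lambda>r. r) A =
    ordered_action.present_entropy M (Z_action M S) \<nu> \<phi> (\<lambda>_ (i, j). i < j) A"
proof -
  interpret G: ordered_action M act \<nu> \<phi> order_act "\<lambda>r. r" A
    by (rule group_ordered_action[OF A])
  interpret Z: ordered_action M "Z_action M S" \<nu> \<phi> order_shift "\<lambda>_ (i, j). i < j" A
    by (rule integer_ordered_action[OF A])
  \<comment> \<open>The dictionary between the two actions: position \<open>k\<close> of the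
    successor orbit is the group element at position \<open>k\<close> of the order.\<close>
  define E where "E x \<longleftrightarrow> x \<in> space M \<and> (\<forall>k. k \<in> Z.visits x \<longleftrightarrow> nth_elem (\<phi> x) k \<in> G.visits x)" for x
  have "AE x in M. \<forall>k. Z_action M S k x = shift k x"
    using AE_Z_action by (simp add: AE_all_countable)
  then have E: "AE x in M. E x"
    using AE_space
    by eventually_elim (simp add: E_def Z.visits_def G.visits_def shift_def)
  have index_sets: "discrete_rv \<nu> (\<lambda>r. {(k, g). nth_elem r k = g \<and> k \<in> K r})"
    if "\<And>r. r \<in> space \<nu> \<Longrightarrow> finite (K r)" "\<And>k. {r \<in> space \<nu>. k \<in> K r} \<in> sets \<nu>"
    for K :: "('g \<times> 'g \<Rightarrow> bool) \<Rightarrow> int set"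
  proof (rule discrete_rv_finite_set[where U = UNIV])
    show "countable (UNIV :: (int \<times> 'g) set)"
      unfolding UNIV_Times_UNIV[symmetric] by (intro countable_SIGMA countable_group) simp
    fix r assume "r \<in> space \<nu>"
    from that(1)[OF this] have "finite ((\<lambda>k. (k, nth_elem r k)) ` K r)" by simp
    moreover have "{(k, g). nth_elem r k = g \<and> k \<in> K r} = (\<lambda>k. (k, nth_elem r k)) ` K r" by auto
    ultimately show "finite {(k, g). nth_elem r k = g \<and> k \<in> K r} \<and>
        {(k, g). nth_elem r k = g \<and> k \<in> K r} \<subseteq> UNIV" by simp
  next
    fix p :: "int \<times> 'g"
    obtain k g where p: "p = (k, g)" by force
    have "{r \<in> space \<nu>. nth_elem r k = g \<and> k \<in> K r} \<in> sets \<nu>"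
      by (intro sets.sets_Collect_conj nth_elem_sets that(2))
    then show "{r \<in> space \<nu>. p \<in> {(k, g). nth_elem r k = g \<and> k \<in> K r}} \<in> sets \<nu>" by (simp add: p)
  qed
  have "G.present_entropy \<le> Z.past_entropy w d" if wd: "Z.admissible w d"
    for w :: "('g \<times> 'g \<Rightarrow> bool) \<Rightarrow> nat" and d
  proof -
    \<comment> \<open>The enumeration restricted to the given positions, stored as a graph: first
      projections are positions, second projections the group elements there.\<close>
    define f where "f r = {(k, g). nth_elem r k = g \<and> k \<in> d (w r)}" for r :: "'g \<times> 'g \<Rightarrow> bool"
    have w: "discrete_rv \<nu> w" and fin: "\<And>r. r \<in> space \<nu> \<Longrightarrow> finite (d (w r))"
      and neg: "\<And>r k. r \<in> space \<nu> \<Longrightarrow> k \<in> d (w r) \<Longrightarrow> k < 0"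
      using wd by (auto simp: Z.admissible_def)
    have f: "discrete_rv \<nu> f"
      unfolding f_def[abs_def] by (intro index_sets fin discrete_rv_pred[OF w])
    have img: "snd ` f r = nth_elem r ` d (w r)" for r by (force simp: f_def)
    have adm: "G.admissible (\<lambda>r. (w r, f r)) (\<lambda>v. snd ` snd v)"
      unfolding G.admissible_def snd_conv img
    proof (intro conjI ballI discrete_rv_Pair w f finite_imageI fin)
      fix r g assume r: "r \<in> space \<nu>" and "g \<in> nth_elem r ` d (w r)"
      then obtain k where "k \<in> d (w r)" "g = nth_elem r k" by auto
      then show "r (g, 0)" using neg[OF r] nth_elem_less[of r k 0] r by (simp add: space_nu)
    qed
    have "G.present_entropy \<le> G.past_entropy (\<lambda>r. (w r, f r)) (\<lambda>v. snd ` snd v)"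
      by (rule G.present_entropy_le[OF adm])
    also have "\<dots> \<le> Z.past_entropy w d"
      unfolding G.past_entropy_eq[OF adm] Z.past_entropy_eq[OF wd]
    proof (rule integral_cond_info_mono[OF discrete_rv_mem[OF A] _ Z.discrete_past_code[OF wd] G.discrete_past_code[OF adm] E])
      fix x y assume Ex: "E x" and Ey: "E y"
        and eq: "G.past_code (\<lambda>r. (w r, f r)) (\<lambda>v. snd ` snd v) x = G.past_code (\<lambda>r. (w r, f r)) (\<lambda>v. snd ` snd v) y"
      note eq' = eq[unfolded G.past_code_def prod.inject snd_conv]
      have ww: "w (\<phi> x) = w (\<phi> y)" and ff: "f (\<phi> x) = f (\<phi> y)"
        using conjunct1[OF eq'] by simp_all
      have vv: "G.visits x \<inter> snd ` f (\<phi> x) = G.visits y \<inter> snd ` f (\<phi> y)"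
        by (rule conjunct2[OF eq'])
      have "k \<in> Z.visits x \<longleftrightarrow> k \<in> Z.visits y" if k: "k \<in> d (w (\<phi> x))" for k
      proof -
        have in_f: "(k, nth_elem (\<phi> x) k) \<in> f (\<phi> x)" using k by (simp add: f_def)
        then have "(k, nth_elem (\<phi> x) k) \<in> f (\<phi> y)" using ff by simp
        then have same: "nth_elem (\<phi> y) k = nth_elem (\<phi> x) k" by (simp add: f_def)
        have "nth_elem (\<phi> x) k \<in> snd ` f (\<phi> x)" using in_f by force
        then have "nth_elem (\<phi> x) k \<in> G.visits x \<longleftrightarrow> nth_elem (\<phi> x) k \<in> G.visits y"
          using vv ff by blast
        then show ?thesis using Ex Ey same by (simp add: E_def)
      qed
      then show "Z.past_code w d x = Z.past_code w d y"
        using ww by (auto simp: Z.past_code_def)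
    qed simp
    finally show ?thesis .
  qed
  then have le: "G.present_entropy \<le> Z.present_entropy"
    by (rule Z.present_entropy_ge)
  have "Z.present_entropy \<le> G.past_entropy w d" if wd: "G.admissible w d"
    for w :: "('g \<times> 'g \<Rightarrow> bool) \<Rightarrow> nat" and d
  proof -
    \<comment> \<open>The negative positions of the elements of \<open>d (w r)\<close>; by
      \<open>nth_elem_past\<close> every such element has one, and injectivity of the enumeration
      keeps \<open>K r\<close> finite.\<close>
    define K where "K r = {k. k < 0 \<and> nth_elem r k \<in> d (w r)}" for r :: "'g \<times> 'g \<Rightarrow> bool"
    define f where "f r = {(k, g). nth_elem r k = g \<and> k \<in> K r}" for r :: "'g \<times> 'g \<Rightarrow> bool"
    have w: "discrete_rv \<nu> w" and dfin: "\<And>r. r \<in> space \<nu> \<Longrightarrow> finite (d (w r))"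
      and past: "\<And>r g. r \<in> space \<nu> \<Longrightarrow> g \<in> d (w r) \<Longrightarrow> r (g, 0)"
      using wd by (auto simp: G.admissible_def)
    have fin: "finite (K r)" if r: "r \<in> space \<nu>" for r
    proof (rule finite_imageD)
      show "finite (nth_elem r ` K r)"
        by (rule finite_subset[OF _ dfin[OF r]]) (auto simp: K_def)
      show "inj_on (nth_elem r) (K r)"
        using nth_elem_inj[of r] r by (auto simp: inj_on_def space_nu)
    qed
    have "{r \<in> space \<nu>. k \<in> K r} \<in> sets \<nu>" for k
    proof -
      have "discrete_rv \<nu> (\<lambda>r. nth_elem r k)"
        using nth_elem_sets countable_subset[OF subset_UNIV countable_group]
        unfolding discrete_rv_def by auto
      from discrete_rv_pred[OF discrete_rv_Pair[OF this w], of "\<lambda>(g, v). k < 0 \<and> g \<in> d v"]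
      show ?thesis by (simp add: K_def)
    qed
    then have f: "discrete_rv \<nu> f"
      unfolding f_def[abs_def] by (intro index_sets fin)
    have img: "fst ` f r = K r" for r by (force simp: f_def)
    have adm: "Z.admissible (\<lambda>r. (w r, f r)) (\<lambda>v. fst ` snd v)"
      unfolding Z.admissible_def snd_conv img
      by (intro conjI ballI discrete_rv_Pair w f fin) (auto simp: K_def)
    have "Z.present_entropy \<le> Z.past_entropy (\<lambda>r. (w r, f r)) (\<lambda>v. fst ` snd v)"
      by (rule Z.present_entropy_le[OF adm])
    also have "\<dots> \<le> G.past_entropy w d"
      unfolding G.past_entropy_eq[OF wd] Z.past_entropy_eq[OF adm]
    proof (rule integral_cond_info_mono[OF discrete_rv_mem[OF A] _ G.discrete_past_code[OF wd] Z.discrete_past_code[OF adm] E])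
      fix x y assume x: "x \<in> space M" and Ex: "E x" and Ey: "E y"
        and eq: "Z.past_code (\<lambda>r. (w r, f r)) (\<lambda>v. fst ` snd v) x = Z.past_code (\<lambda>r. (w r, f r)) (\<lambda>v. fst ` snd v) y"
      note eq' = eq[unfolded Z.past_code_def prod.inject snd_conv]
      have ww: "w (\<phi> x) = w (\<phi> y)" and ff: "f (\<phi> x) = f (\<phi> y)"
        using conjunct1[OF eq'] by simp_all
      have vv: "Z.visits x \<inter> fst ` f (\<phi> x) = Z.visits y \<inter> fst ` f (\<phi> y)"
        by (rule conjunct2[OF eq'])
      have "g \<in> G.visits x \<longleftrightarrow> g \<in> G.visits y" if g: "g \<in> d (w (\<phi> x))" for g
      proof -
        have "\<phi> x \<in> space \<nu>" using x phi_Z space_nu by simp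
        from past[OF this g] obtain k where k: "k < 0" "nth_elem (\<phi> x) k = g"
          using nth_elem_past[OF phi_Z[OF x]] by blast
        then have in_f: "(k, g) \<in> f (\<phi> x)" using g by (simp add: f_def K_def)
        then have "(k, g) \<in> f (\<phi> y)" using ff by simp
        then have same: "nth_elem (\<phi> y) k = g" by (simp add: f_def)
        have "k \<in> fst ` f (\<phi> x)" using in_f by force
        then have "k \<in> Z.visits x \<longleftrightarrow> k \<in> Z.visits y"
          using vv ff by blast
        then show ?thesis using Ex Ey same k(2) by (simp add: E_def)
      qed
      then show "G.past_code w d x = G.past_code w d y"
        using ww by (auto simp: G.past_code_def)
    qed simp
    finally show ?thesis .
  qed
  then have "Z.present_entropy \<le> G.present_entropy"
    by (rule G.present_entropy_ge)
  with le show ?thesis by simp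
qed

section \<open>Equality of the relative entropies and of the Pinsker algebras\<close>

lemma rel_entropy_eq:
  assumes A: "A \<in> sets M" and F: "\<exists>F :: nat \<Rightarrow> 'g set. folner F"
  shows "rel_entropy M act {A, space M - A} (multiorder_algebra M \<phi>) =
    rel_entropy M (Z_action M S) {A, space M - A} (multiorder_algebra M \<phi>)"
proof -
  have "multiorder_algebra M \<phi> = {\<phi> -` B \<inter> space M | B. B \<in> sets \<nu>}"
    by (simp add: multiorder_algebra_def sets_nu)
  moreover have "\<exists>F :: nat \<Rightarrow> int set. folner F"
    using folner_int by blast
  ultimately show ?thesis
    using ordered_action.rel_entropy_eq[OF group_ordered_action[OF A] F]
      ordered_action.rel_entropy_eq[OF integer_ordered_action[OF A]] present_entropy_eq[OF A]
    by simp
qed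

end

theorem theorem7p1:
  fixes M :: "'x measure"
    and act :: "'g::group_add \<Rightarrow> 'x \<Rightarrow> 'x"
    and \<nu> :: "('g \<times> 'g \<Rightarrow> bool) measure"
    and \<phi> :: "'x \<Rightarrow> 'g \<times> 'g \<Rightarrow> bool"
  assumes "countable_amenable_group TYPE('g)"
    and "standard_prob_space M"
    and "pmp_action M act"
    and "multiorder \<nu>"
    and "factor_map M act \<nu> order_act \<phi>"
  shows "pinsker M act (multiorder_algebra M \<phi>)
       = pinsker M (Z_action M (successor_map act \<phi>)) (multiorder_algebra M \<phi>)"
proof -
  interpret multiordered_system M act \<nu> \<phi>
    using assms
    by (auto simp: countable_amenable_group_def pmp_action_def
        intro!: multiordered_system.intro multiordered_system_axioms.intro)
  have "\<exists>F :: nat \<Rightarrow> 'g set. folner F"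
    using assms(1) by (simp add: countable_amenable_group_def)
  then show ?thesis unfolding pinsker_def using rel_entropy_eq by auto
qed

end
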